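(* Let $\Omega\subset\mathbb R^N$ be a bounded open set, $0<s<1$, and let $f:\Omega\times\mathbb R\to\mathbb R$ satisfy the structural and global $(\triangle_2)$ conditions listed in the context. Let $\mathcal V=\mathbb H^s(\Omega)\cap L_F(\Omega)$. Then for every $g\in\mathcal V^\star$ the problem $$(-\Delta_D)^su+f(x,u)=g\ \text{ in }\Omega,\qquad u=0\ \text{ on }\partial\Omega,$$ has a unique weak solution $u\in\mathcal V$. In addition, there exists a constant $C>0$, independent of $g$, such that if $g\in\mathbb H^{-s}(\Omega):=(\mathbb H^s(\Omega))^\star$, then $$\|u\|_{\mathbb H^s(\Omega)}\le C\|g\|_{\mathbb H^{-s}(\Omega)}.$$
   Context: Spectral fractional Laplacian. $\Omega\subset\mathbb R^N$ is an arbitrary bounded open set, and $-\Delta_D$ is the positive self-adjoint operator on $L^2(\Omega)$ associated with the form $\int_\Omega\nabla u\cdot\nabla v\,dx$, $u,v\in H^1_0(\Omega)$ (closure of $C_c^\infty(\Omega)$ in $H^1(\Omega)$). Its eigenvalues are $0<\lambda_1\le\lambda_2\le\cdots\to\infty$, with $L^2$-orthonormal eigenfunctions $\varphi_n$. For $r\ge0$, $\mathbb H^r(\Omega)=\{u=\sum_n u_n\varphi_n\in L^2(\Omega):\|u\|_{\mathbb H^r(\Omega)}^2:=\sum_n\lambda_n^r u_n^2<\infty\}$, $u_n=\int_\Omega u\varphi_n\,dx$. For $r\in(0,1)$, $(-\Delta_D)^r u=\sum_n\lambda_n^r u_n\varphi_n$, so that $\|u\|_{\mathbb H^s(\Omega)}=\|(-\Delta_D)^{s/2}u\|_{L^2(\Omega)}$.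 Conditions on $f$. (i) For a.e. $x\in\Omega$: $f(x,\cdot)$ is odd, strictly increasing and continuous, $f(x,0)=0$ and $\lim_{t\to\infty}f(x,t)=\infty$; for all $t\in\mathbb R$, $f(\cdot,t)$ is measurable. Let $\widetilde f(x,\cdot)$ be the inverse function of $f(x,\cdot)$, and $F(x,t)=\int_0^{|t|}f(x,\tau)\,d\tau$, $\widetilde F(x,t)=\int_0^{|t|}\widetilde f(x,\tau)\,d\tau$. (ii) Global $(\triangle_2)$-condition: there are constants $c_1,c_2\in(0,1]$, independent of $x$, such that for a.e. $x\in\Omega$ and all $t\ge0$, $c_1tf(x,t)\le F(x,t)\le tf(x,t)$ and $c_2t\widetilde f(x,t)\le\widetilde F(x,t)\le t\widetilde f(x,t)$. Spaces. $L_F(\Omega)=\{u:\Omega\to\mathbb R\text{ measurable}: F(\cdot,u(\cdot))\in L^1(\Omega)\}$ with the Luxemburg norm $\|u\|_{F,\Omega}=\inf\{k>0:\int_\Omega F(x,u(x)/k)\,dx\le1\}$. $\mathcal V=\{u\in\mathbb H^s(\Omega):F(\cdot,u(\cdot))\in L^1(\Omega)\}$ with norm $\|u\|_{\mathcal V}=\|u\|_{\mathbb H^s(\Omega)}+\|u\|_{F,\Omega}$. $\mathcal V^\star$ is its dual, with duality pairing $\langle\cdot,\cdot\rangle$; elements of $\mathbb H^{-s}(\Omega)$ are regarded as elements of $\mathcal V^\star$ by restriction to $\mathcal V$. Weak solution. For $g\in\mathcal V^\star$, $u\in\mathcal V$ is a weak solution if $\int_\Omega(-\Delta_D)^{s/2}u\,(-\Delta_D)^{s/2}v\,dx+\int_\Omega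 f(x,u)v\,dx=\langle g,v\rangle$ for every $v\in\mathcal V$. *)

theory Defs
  imports "HOL-Analysis.Analysis"
begin

text \<open>Elements of \<open>L\<^sup>2(\<Omega>)\<close> and of all spaces below are represented by functions on the ambient
  space; only their values on \<open>\<Omega>\<close> matter, and equality is equality a.e. on \<open>\<Omega>\<close>.\<close>

section \<open>\<open>L\<^sup>2\<close>, \<open>C\<^sub>c\<^sup>\<infinity>\<close> and Sobolev spaces\<close>

definition L2 :: "'a::euclidean_space set \<Rightarrow> ('a \<Rightarrow> 'b::euclidean_space) set" where
  "L2 \<Omega> = {u \<in> borel_measurable (lebesgue_on \<Omega>).
             integrable (lebesgue_on \<Omega>) (\<lambda>x. (norm (u x))\<^sup>2)}"

definition L2_norm :: "'a::euclidean_space set \<Rightarrow> ('a \<Rightarrow> 'b::euclidean_space) \<Rightarrow> real" where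
  "L2_norm \<Omega> u = sqrt (LINT x|lebesgue_on \<Omega>. (norm (u x))\<^sup>2)"

definition partial_deriv :: "'a::euclidean_space \<Rightarrow> ('a \<Rightarrow> real) \<Rightarrow> 'a \<Rightarrow> real" where
  "partial_deriv i \<psi> = (\<lambda>x. frechet_derivative \<psi> (at x) i)"

text \<open>\<open>k\<close> times differentiable, with continuous partial derivatives of order \<open>k\<close>.\<close>

primrec Ck :: "nat \<Rightarrow> ('a::euclidean_space \<Rightarrow> real) \<Rightarrow> bool" where
  "Ck 0 \<psi> \<longleftrightarrow> continuous_on UNIV \<psi>"
| "Ck (Suc k) \<psi> \<longleftrightarrow> (\<forall>x. \<psi> differentiable (at x)) \<and> (\<forall>i\<in>Basis. Ck k (partial_deriv i \<psi>))"

definition Cc_infinity :: "'a::euclidean_space set \<Rightarrow> ('a \<Rightarrow> real) set" where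
  "Cc_infinity \<Omega> = {\<psi>. (\<forall>k. Ck k \<psi>) \<and> compact (closure {x. \<psi> x \<noteq> 0}) \<and>
                         closure {x. \<psi> x \<noteq> 0} \<subseteq> \<Omega>}"

definition has_weak_gradient ::
    "'a::euclidean_space set \<Rightarrow> ('a \<Rightarrow> real) \<Rightarrow> ('a \<Rightarrow> 'a) \<Rightarrow> bool" where
  "has_weak_gradient \<Omega> u G \<longleftrightarrow>
     (\<forall>\<psi>\<in>Cc_infinity \<Omega>. \<forall>i\<in>Basis.
        (LINT x|lebesgue_on \<Omega>. u x * partial_deriv i \<psi> x)
          = - (LINT x|lebesgue_on \<Omega>. (G x \<bullet> i) * \<psi> x))"

definition H1 :: "'a::euclidean_space set \<Rightarrow> ('a \<Rightarrow> real) set" where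
  "H1 \<Omega> = {u \<in> L2 \<Omega>. \<exists>G\<in>L2 \<Omega>. has_weak_gradient \<Omega> u G}"

text \<open>A representative of the a.e. unique weak gradient of an element of \<open>H\<^sup>1(\<Omega>)\<close>.\<close>

definition weak_gradient :: "'a::euclidean_space set \<Rightarrow> ('a \<Rightarrow> real) \<Rightarrow> 'a \<Rightarrow> 'a" where
  "weak_gradient \<Omega> u = (SOME G. G \<in> L2 \<Omega> \<and> has_weak_gradient \<Omega> u G)"

definition H1_norm :: "'a::euclidean_space set \<Rightarrow> ('a \<Rightarrow> real) \<Rightarrow> real" where
  "H1_norm \<Omega> u = sqrt ((L2_norm \<Omega> u)\<^sup>2 + (L2_norm \<Omega> (weak_gradient \<Omega> u))\<^sup>2)"

definition H10 :: "'a::euclidean_space set \<Rightarrow> ('a \<Rightarrow> real) set" where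
  "H10 \<Omega> = {u \<in> H1 \<Omega>. \<exists>\<psi>. (\<forall>k::nat. \<psi> k \<in> Cc_infinity \<Omega>) \<and>
                            (\<lambda>k. H1_norm \<Omega> (\<lambda>x. \<psi> k x - u x)) \<longlonglongrightarrow> 0}"

section \<open>The Dirichlet Laplacian and its spectral powers\<close>

text \<open>\<open>neg_dirichlet_laplacian \<Omega> u w\<close>: \<open>u\<close> is in the domain of the operator on \<open>L\<^sup>2(\<Omega>)\<close> associated
  with the form \<open>\<integral>\<nabla>u\<cdot>\<nabla>v\<close> on \<open>H\<^sup>1\<^sub>0(\<Omega>)\<close>, and its image is \<open>w\<close>.\<close>

definition neg_dirichlet_laplacian ::
    "'a::euclidean_space set \<Rightarrow> ('a \<Rightarrow> real) \<Rightarrow> ('a \<Rightarrow> real) \<Rightarrow> bool" where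
  "neg_dirichlet_laplacian \<Omega> u w \<longleftrightarrow> u \<in> H10 \<Omega> \<and> w \<in> L2 \<Omega> \<and>
     (\<forall>v\<in>H10 \<Omega>. (LINT x|lebesgue_on \<Omega>. weak_gradient \<Omega> u x \<bullet> weak_gradient \<Omega> v x)
                  = (LINT x|lebesgue_on \<Omega>. w x * v x))"

definition fourier_coeff ::
    "'a::euclidean_space set \<Rightarrow> (nat \<Rightarrow> 'a \<Rightarrow> real) \<Rightarrow> ('a \<Rightarrow> real) \<Rightarrow> nat \<Rightarrow> real" where
  "fourier_coeff \<Omega> \<phi> u n = (LINT x|lebesgue_on \<Omega>. u x * \<phi> n x)"

definition L2_sums ::
    "'a::euclidean_space set \<Rightarrow> (nat \<Rightarrow> 'a \<Rightarrow> real) \<Rightarrow> ('a \<Rightarrow> real) \<Rightarrow> bool" where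
  "L2_sums \<Omega> h w \<longleftrightarrow> w \<in> L2 \<Omega> \<and>
     (\<lambda>k. L2_norm \<Omega> (\<lambda>x. (\<Sum>n<k. h n x) - w x)) \<longlonglongrightarrow> 0"

text \<open>\<open>\<phi>\<close> is a complete orthonormal system of eigenfunctions, so \<open>\<Lambda>\<close> lists all eigenvalues
  according to multiplicity. Indices start at 0: \<open>\<Lambda> 0\<close> is the first eigenvalue.\<close>

definition dirichlet_eigensystem ::
    "'a::euclidean_space set \<Rightarrow> (nat \<Rightarrow> real) \<Rightarrow> (nat \<Rightarrow> 'a \<Rightarrow> real) \<Rightarrow> bool" where
  "dirichlet_eigensystem \<Omega> \<Lambda> \<phi> \<longleftrightarrow>
     0 < \<Lambda> 0 \<and> mono \<Lambda> \<and> filterlim \<Lambda> at_top sequentially \<and>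
     (\<forall>n. neg_dirichlet_laplacian \<Omega> (\<phi> n) (\<lambda>x. \<Lambda> n * \<phi> n x)) \<and>
     (\<forall>m n. (LINT x|lebesgue_on \<Omega>. \<phi> m x * \<phi> n x) = (if m = n then 1 else 0)) \<and>
     (\<forall>u\<in>L2 \<Omega>. L2_sums \<Omega> (\<lambda>n x. fourier_coeff \<Omega> \<phi> u n * \<phi> n x) u)"

definition Hr :: "'a::euclidean_space set \<Rightarrow> (nat \<Rightarrow> real) \<Rightarrow> (nat \<Rightarrow> 'a \<Rightarrow> real) \<Rightarrow> real
    \<Rightarrow> ('a \<Rightarrow> real) set" where
  "Hr \<Omega> \<Lambda> \<phi> r = {u \<in> L2 \<Omega>. summable (\<lambda>n. \<Lambda> n powr r * (fourier_coeff \<Omega> \<phi> u n)\<^sup>2)}"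

definition Hr_norm :: "'a::euclidean_space set \<Rightarrow> (nat \<Rightarrow> real) \<Rightarrow> (nat \<Rightarrow> 'a \<Rightarrow> real) \<Rightarrow> real
    \<Rightarrow> ('a \<Rightarrow> real) \<Rightarrow> real" where
  "Hr_norm \<Omega> \<Lambda> \<phi> r u = sqrt (\<Sum>n. \<Lambda> n powr r * (fourier_coeff \<Omega> \<phi> u n)\<^sup>2)"

text \<open>A representative of \<open>(-\<Delta>\<^sub>D)\<^sup>r u\<close>; for \<open>u \<in> L\<^sup>2(\<Omega>)\<close> the
  series converges in \<open>L\<^sup>2(\<Omega>)\<close> iff \<open>u\<close> is in \<open>\<H>\<^sup>2\<^sup>r(\<Omega>)\<close>.\<close>

definition frac_laplacian :: "'a::euclidean_space set \<Rightarrow> (nat \<Rightarrow> real) \<Rightarrow> (nat \<Rightarrow> 'a \<Rightarrow> real) \<Rightarrow> real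
    \<Rightarrow> ('a \<Rightarrow> real) \<Rightarrow> 'a \<Rightarrow> real" where
  "frac_laplacian \<Omega> \<Lambda> \<phi> r u =
     (SOME w. L2_sums \<Omega> (\<lambda>n x. \<Lambda> n powr r * fourier_coeff \<Omega> \<phi> u n * \<phi> n x) w)"

section \<open>The nonlinearity and its Musielak--Orlicz space\<close>

definition structural_condition ::
    "'a::euclidean_space set \<Rightarrow> ('a \<Rightarrow> real \<Rightarrow> real) \<Rightarrow> bool" where
  "structural_condition \<Omega> f \<longleftrightarrow>
     (AE x in lebesgue_on \<Omega>. (\<forall>t. f x (- t) = - f x t) \<and> strict_mono (f x) \<and>
        continuous_on UNIV (f x) \<and> f x 0 = 0 \<and> filterlim (f x) at_top at_top) \<and>
     (\<forall>t. (\<lambda>x. f x t) \<in> borel_measurable (lebesgue_on \<Omega>))"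

definition even_primitive :: "('a \<Rightarrow> real \<Rightarrow> real) \<Rightarrow> 'a \<Rightarrow> real \<Rightarrow> real" where
  "even_primitive f x t = integral {0..\<bar>t\<bar>} (f x)"

definition fibre_inverse :: "('a \<Rightarrow> real \<Rightarrow> real) \<Rightarrow> 'a \<Rightarrow> real \<Rightarrow> real" where
  "fibre_inverse f x = inv (f x)"

definition global_Delta2 ::
    "'a::euclidean_space set \<Rightarrow> ('a \<Rightarrow> real \<Rightarrow> real) \<Rightarrow> bool" where
  "global_Delta2 \<Omega> f \<longleftrightarrow>
     (\<exists>c1\<in>{0<..1}. \<exists>c2\<in>{0<..1}. AE x in lebesgue_on \<Omega>. \<forall>t\<ge>0.
        c1 * (t * f x t) \<le> even_primitive f x t \<and> even_primitive f x t \<le> t * f x t \<and>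
        c2 * (t * fibre_inverse f x t) \<le> even_primitive (fibre_inverse f) x t \<and>
        even_primitive (fibre_inverse f) x t \<le> t * fibre_inverse f x t)"

definition LF :: "'a::euclidean_space set \<Rightarrow> ('a \<Rightarrow> real \<Rightarrow> real) \<Rightarrow> ('a \<Rightarrow> real) set" where
  "LF \<Omega> f = {u \<in> borel_measurable (lebesgue_on \<Omega>).
               integrable (lebesgue_on \<Omega>) (\<lambda>x. even_primitive f x (u x))}"

text \<open>The modular is a nonnegative integral with values in \<open>[0,\<infinity>]\<close>, so that a value \<open>k\<close> with
  non-integrable integrand does not count as admissible.\<close>

definition luxemburg_norm ::
    "'a::euclidean_space set \<Rightarrow> ('a \<Rightarrow> real \<Rightarrow> real) \<Rightarrow> ('a \<Rightarrow> real) \<Rightarrow> real" where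
  "luxemburg_norm \<Omega> f u =
     Inf {k. k > 0 \<and> (\<integral>\<^sup>+ x. ennreal (even_primitive f x (u x / k)) \<partial>lebesgue_on \<Omega>) \<le> 1}"

section \<open>The energy space, duals, weak solutions\<close>

definition energy_space :: "'a::euclidean_space set \<Rightarrow> (nat \<Rightarrow> real) \<Rightarrow> (nat \<Rightarrow> 'a \<Rightarrow> real) \<Rightarrow> real
    \<Rightarrow> ('a \<Rightarrow> real \<Rightarrow> real) \<Rightarrow> ('a \<Rightarrow> real) set" where
  "energy_space \<Omega> \<Lambda> \<phi> s f = Hr \<Omega> \<Lambda> \<phi> s \<inter> LF \<Omega> f"

definition energy_norm :: "'a::euclidean_space set \<Rightarrow> (nat \<Rightarrow> real) \<Rightarrow> (nat \<Rightarrow> 'a \<Rightarrow> real) \<Rightarrow> real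
    \<Rightarrow> ('a \<Rightarrow> real \<Rightarrow> real) \<Rightarrow> ('a \<Rightarrow> real) \<Rightarrow> real" where
  "energy_norm \<Omega> \<Lambda> \<phi> s f u = Hr_norm \<Omega> \<Lambda> \<phi> s u + luxemburg_norm \<Omega> f u"

text \<open>Bounded linear functionals on a function space \<open>V\<close> with (semi)norm \<open>N\<close>. The values of a
  functional outside \<open>V\<close> are irrelevant, so that restriction to a subspace leaves the HOL function
  unchanged. Boundedness forces functions that agree a.e. to have the same value.\<close>

definition dual_space ::
    "('a \<Rightarrow> real) set \<Rightarrow> (('a \<Rightarrow> real) \<Rightarrow> real) \<Rightarrow> (('a \<Rightarrow> real) \<Rightarrow> real) set" where
  "dual_space V N = {g. (\<forall>u\<in>V. \<forall>v\<in>V. g (\<lambda>x. u x + v x) = g u + g v) \<and>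
                        (\<forall>c. \<forall>u\<in>V. g (\<lambda>x. c * u x) = c * g u) \<and>
                        (\<exists>C. \<forall>u\<in>V. \<bar>g u\<bar> \<le> C * N u)}"

definition dual_norm ::
    "('a \<Rightarrow> real) set \<Rightarrow> (('a \<Rightarrow> real) \<Rightarrow> real) \<Rightarrow> (('a \<Rightarrow> real) \<Rightarrow> real) \<Rightarrow> real" where
  "dual_norm V N g = (SUP v\<in>{v\<in>V. N v \<le> 1}. \<bar>g v\<bar>)"

definition weak_solution :: "'a::euclidean_space set \<Rightarrow> (nat \<Rightarrow> real) \<Rightarrow> (nat \<Rightarrow> 'a \<Rightarrow> real) \<Rightarrow> real
    \<Rightarrow> ('a \<Rightarrow> real \<Rightarrow> real) \<Rightarrow> (('a \<Rightarrow> real) \<Rightarrow> real) \<Rightarrow> ('a \<Rightarrow> real) \<Rightarrow> bool" where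
  "weak_solution \<Omega> \<Lambda> \<phi> s f g u \<longleftrightarrow> u \<in> energy_space \<Omega> \<Lambda> \<phi> s f \<and>
     (\<forall>v\<in>energy_space \<Omega> \<Lambda> \<phi> s f.
        (LINT x|lebesgue_on \<Omega>. frac_laplacian \<Omega> \<Lambda> \<phi> (s/2) u x * frac_laplacian \<Omega> \<Lambda> \<phi> (s/2) v x)
        + (LINT x|lebesgue_on \<Omega>. f x (u x) * v x) = g v)"

section \<open>The dual of \<open>\<H>\<^sup>s(\<Omega>)\<close> maps into the dual of the energy space by restriction\<close>

lemma even_primitive_scale_le:
  assumes cont: "continuous_on UNIV (f x)" and mono: "strict_mono (f x)" and "k \<ge> (1::real)"
  shows "even_primitive f x (t / k) \<le> even_primitive f x t / k"
proof -
  have k: "k > 0" using assms by simp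
  have int: "f x integrable_on {a..b}" for a b
    by (rule integrable_continuous_interval) (use cont continuous_on_subset in blast)
  have "((\<lambda>y. f x ((1/k) * y + 0)) has_integral (1 / \<bar>1/k\<bar>) *\<^sub>R integral {0..\<bar>t\<bar>/k} (f x))
          ((\<lambda>y. (1/(1/k)) *\<^sub>R y + -((1/(1/k)) *\<^sub>R 0)) ` cbox 0 (\<bar>t\<bar>/k))"
    using has_integral_affinity[OF integrable_integral[OF int, of 0 "\<bar>t\<bar>/k", folded cbox_interval],
        of "1/k" 0] k
    by (simp only: cbox_interval[symmetric]) simp
  moreover have "(\<lambda>y. (1/(1/k)) *\<^sub>R y + -((1/(1/k)) *\<^sub>R 0)) ` cbox 0 (\<bar>t\<bar>/k) = {0..\<bar>t\<bar>}"
    using k by (simp add: cbox_interval image_mult_atLeastAtMost)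
  ultimately have A: "((\<lambda>y. f x (y / k)) has_integral k * integral {0..\<bar>t\<bar>/k} (f x)) {0..\<bar>t\<bar>}"
    using k by simp
  have "k * integral {0..\<bar>t\<bar>/k} (f x) \<le> integral {0..\<bar>t\<bar>} (f x)"
    by (rule has_integral_le[OF A integrable_integral[OF int]])
       (use assms k strict_mono_less_eq[OF mono] in \<open>auto simp: field_simps mult_le_cancel_left1 intro: mult_left_mono\<close>)
  then show ?thesis
    using k by (simp add: even_primitive_def field_simps)
qed

lemma luxemburg_norm_nonneg:
  assumes f: "structural_condition \<Omega> f" and u: "u \<in> LF \<Omega> f"
  shows "luxemburg_norm \<Omega> f u \<ge> 0"
proof -
  let ?M = "lebesgue_on \<Omega>" and ?F = "\<lambda>x. even_primitive f x (u x)"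
  define I where "I = (\<integral>\<^sup>+ x. ennreal (?F x) \<partial>?M)"
  have int: "integrable ?M ?F" using u by (simp add: LF_def)
  have "(\<integral>\<^sup>+ x. ennreal (?F x) \<partial>?M) \<le> (\<integral>\<^sup>+ x. ennreal (norm (?F x)) \<partial>?M)"
    by (intro nn_integral_mono ennreal_leI) auto
  also have "\<dots> < \<infinity>" using int by (simp add: integrable_iff_bounded)
  finally have "I < \<infinity>" by (simp add: I_def)
  then obtain r where r: "I = ennreal r" "r \<ge> 0" by (cases I) auto
  define k where "k = max 1 r"
  have k: "k \<ge> 1" "r \<le> k" by (auto simp: k_def)
  have "AE x in ?M. continuous_on UNIV (f x) \<and> strict_mono (f x)"
    using f by (auto simp: structural_condition_def)
  then have "AE x in ?M. ennreal (even_primitive f x (u x / k)) \<le> ennreal (1/k) * ennreal (?F x)"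
  proof eventually_elim
    case (elim x)
    then have "even_primitive f x (u x / k) \<le> (1/k) * ?F x"
      using even_primitive_scale_le[of f x k "u x"] k by simp
    then have "ennreal (even_primitive f x (u x / k)) \<le> ennreal ((1/k) * ?F x)"
      by (rule ennreal_leI)
    then show ?case using k ennreal_mult'[of "1/k" "?F x"] by simp
  qed
  then have "(\<integral>\<^sup>+ x. ennreal (even_primitive f x (u x / k)) \<partial>?M)
               \<le> (\<integral>\<^sup>+ x. ennreal (1/k) * ennreal (?F x) \<partial>?M)"
    by (rule nn_integral_mono_AE)
  also have "\<dots> = ennreal (1/k) * I"
    unfolding I_def using int by (intro nn_integral_cmult) auto
  also have "\<dots> = ennreal ((1/k) * r)"
    using r k by (subst ennreal_mult) auto
  also have "\<dots> \<le> ennreal 1"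
    using k by (intro ennreal_leI) (simp add: field_simps)
  finally have "k \<in> {k. k > 0 \<and> (\<integral>\<^sup>+ x. ennreal (even_primitive f x (u x / k)) \<partial>?M) \<le> 1}"
    using k by simp
  then show ?thesis
    unfolding luxemburg_norm_def by (intro cInf_greatest) auto
qed

lemma dual_Hr_subset_dual_energy_space:
  assumes f: "structural_condition \<Omega> f"
  shows "dual_space (Hr \<Omega> \<Lambda> \<phi> s) (Hr_norm \<Omega> \<Lambda> \<phi> s)
           \<subseteq> dual_space (energy_space \<Omega> \<Lambda> \<phi> s f) (energy_norm \<Omega> \<Lambda> \<phi> s f)"
proof
  fix g assume g: "g \<in> dual_space (Hr \<Omega> \<Lambda> \<phi> s) (Hr_norm \<Omega> \<Lambda> \<phi> s)"
  then obtain C where C: "\<And>u. u \<in> Hr \<Omega> \<Lambda> \<phi> s \<Longrightarrow> \<bar>g u\<bar> \<le> C * Hr_norm \<Omega> \<Lambda> \<phi> s u"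
    unfolding dual_space_def by blast
  have "\<bar>g u\<bar> \<le> \<bar>C\<bar> * energy_norm \<Omega> \<Lambda> \<phi> s f u" if u: "u \<in> energy_space \<Omega> \<Lambda> \<phi> s f" for u
  proof -
    have uH: "u \<in> Hr \<Omega> \<Lambda> \<phi> s" and uF: "u \<in> LF \<Omega> f" using u by (auto simp: energy_space_def)
    have "Hr_norm \<Omega> \<Lambda> \<phi> s u \<ge> 0"
      using uH by (auto simp: Hr_norm_def Hr_def intro!: suminf_nonneg)
    then have "C * Hr_norm \<Omega> \<Lambda> \<phi> s u \<le> \<bar>C\<bar> * energy_norm \<Omega> \<Lambda> \<phi> s f u"
      using luxemburg_norm_nonneg[OF f uF]
      by (intro mult_mono) (auto simp: energy_norm_def)
    with C[OF uH] show ?thesis by linarith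
  qed
  with g show "g \<in> dual_space (energy_space \<Omega> \<Lambda> \<phi> s f) (energy_norm \<Omega> \<Lambda> \<phi> s f)"
    unfolding dual_space_def energy_space_def by blast
qed

end

theory Submission
  imports Defs
begin

text \<open>The weak solution is the minimiser over the energy space of
  \<open>J u = \<parallel>u\<parallel>\<^sup>2 / 2 + \<integral> F(x, u) - g u\<close>, where the norm is that of \<open>\<H>\<^sup>s\<close>.
  The \<open>\<triangle>\<^sub>2\<close>-condition on the inverse functions makes \<open>F\<close> superlinear uniformly in \<open>x\<close>, so that \<open>J\<close>
  is coercive. By the parallelogram law a minimising sequence is Cauchy in \<open>\<H>\<^sup>s\<close>; a subsequence
  converges a.e. to some \<open>u\<close>, and \<open>\<integral> F(x, u)\<close> is lower semicontinuous along it by Fatou. Since the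
  energy space is not known to be reflexive, weak continuity of \<open>g\<close> is replaced by a Banach--Saks
  argument: \<open>g\<close> cannot stay bounded away from zero on a sequence with bounded modular tending to
  zero in \<open>\<H>\<^sup>s\<close> and a.e. The Euler--Lagrange equation follows from convexity and dominated
  convergence, uniqueness from monotonicity of \<open>f\<close>, and the estimate by testing with \<open>u\<close> itself.\<close>

section \<open>Functions satisfying the \<open>\<triangle>\<^sub>2\<close>-condition\<close>

text \<open>The recurring difficulty is that \<open>dual_space\<close> bounds a functional by the
  Luxemburg norm, whereas \<open>J\<close> and the limit arguments see only the modular.
  Superlinearity translates between the two: the norm is at most a constant plus an arbitrarily
  small multiple of the modular. Coercivity spends this with the multiple 1/2, the averaging
  argument with a multiple tuned to the growth of the modular of its sums. The condition on
  \<open>f\<close> itself does other work: it makes the energy space a vector space, makes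
  \<open>f x (u x) * v x\<close> integrable and supplies integrable majorants. All constants must be
  chosen before the point \<open>x\<close>, since a bound is integrated over the domain afterwards;
  hence the growth lemmas fix \<open>K\<close> first and quantify over the functions
  \<open>h\<close> later. Along the minimising sequence the modular may drop in the limit. This is
  harmless: energies, modulars and values of \<open>J\<close> converge along a subsequence, so
  \<open>g\<close> of the differences to the limit function converges to some \<delta>, and \<delta>
  \<le> 0 is all that minimality requires.\<close>

lemma primitive_growth:
  fixes c L :: real
  assumes c: "0 < c" "c \<le> 1"
  obtains K where "K \<ge> 1"
    and "\<And>h t. mono h \<Longrightarrow> h 0 = 0 \<Longrightarrow> (\<And>t. t \<ge> 0 \<Longrightarrow> c * (t * h t) \<le> integral {0..t} h) \<Longrightarrow> t \<ge> 0
           \<Longrightarrow> integral {0..L * t} h \<le> K * integral {0..t} h"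
proof -
  \<comment> \<open>The factor is chosen so that the increment over
    \<open>{t..\<sigma> * t}\<close>, at most \<open>(\<sigma> - 1) * t * h (\<sigma> * t)\<close>,
    is at most half of the primitive at \<open>\<sigma> * t\<close>. Absorbing it shows that
    stretching by \<sigma> at most doubles the primitive, and \<open>m\<close> doublings cover the
    factor \<open>L\<close>.\<close>
  define \<sigma> where "\<sigma> = 1 / (1 - c/2)"
  have \<sigma>: "\<sigma> > 1" "\<sigma> - 1 = c / 2 * \<sigma>" using c by (auto simp: \<sigma>_def field_simps)
  then obtain m where m: "L < \<sigma> ^ m" using real_arch_pow by blast
  show thesis
  proof
    show "(2::real) ^ m \<ge> 1" by simp
    fix h :: "real \<Rightarrow> real" and t :: real
    assume h: "mono h" "h 0 = 0" and lower: "\<And>t. t \<ge> 0 \<Longrightarrow> c * (t * h t) \<le> integral {0..t} h"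
      and t: "t \<ge> 0"
    \<comment> \<open>Integrability comes from monotonicity, so the bound applies to the inverse
      functions as well as to the functions \<open>f x\<close>.\<close>
    have int: "h integrable_on {a..b}" for a b
      by (intro integrable_on_mono_on) (use h in \<open>auto simp: mono_on_def mono_def\<close>)
    have nn: "h x \<ge> 0" if "x \<ge> 0" for x using h that monoD by metis
    have step: "integral {0..\<sigma> * t} h \<le> 2 * integral {0..t} h" if t: "t \<ge> 0" for t
    proof -
      have le: "t \<le> \<sigma> * t" using t \<sigma> by (simp add: mult_le_cancel_right1)
      have split: "integral {0..t} h + integral {t..\<sigma> * t} h = integral {0..\<sigma> * t} h"
        by (rule Henstock_Kurzweil_Integration.integral_combine[OF t le int])
      have "integral {t..\<sigma> * t} h \<le> integral {t..\<sigma> * t} (\<lambda>_. h (\<sigma> * t))"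
        by (rule integral_le) (use int h monoD in \<open>auto simp: mono_def\<close>)
      also have "\<dots> = (\<sigma> - 1) * t * h (\<sigma> * t)"
        using le by (simp add: algebra_simps)
      also have "\<dots> = (c * (\<sigma> * t * h (\<sigma> * t))) / 2"
        by (simp add: \<sigma>)
      also have "\<dots> \<le> integral {0..\<sigma> * t} h / 2"
        using lower[of "\<sigma> * t"] t \<sigma> by simp
      finally show ?thesis using split by simp
    qed
    have iterate: "integral {0..\<sigma> ^ k * t} h \<le> 2 ^ k * integral {0..t} h" for k
    proof (induction k)
      case (Suc k)
      have "integral {0..\<sigma> ^ Suc k * t} h \<le> 2 * integral {0..\<sigma> ^ k * t} h"
        using step[of "\<sigma> ^ k * t"] t \<sigma> by (simp add: mult.assoc)
      with Suc show ?case by simp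
    qed simp
    have "integral {0..L * t} h \<le> integral {0..\<sigma> ^ m * t} h"
      by (rule integral_subset_le) (use m t int nn in \<open>auto intro: mult_right_mono order_trans\<close>)
    with iterate[of m] show "integral {0..L * t} h \<le> 2 ^ m * integral {0..t} h" by linarith
  qed
qed

text \<open>This is one fibre \<open>f x\<close> with \<open>x\<close> frozen. Pointwise facts are
  proved here without a.e. quantifiers and transferred later for almost every
  \<open>x\<close>.\<close>

locale odd_increasing =
  fixes h :: "real \<Rightarrow> real"
  assumes odd: "h (- t) = - h t"
    and strict_mono: "strict_mono h"
    and continuous: "continuous_on UNIV h"
    and zero: "h 0 = 0"
    and at_top: "filterlim h at_top at_top"
begin

definition H :: "real \<Rightarrow> real" where "H t = integral {0..\<bar>t\<bar>} h"

lemma integrable: "h integrable_on {a..b}"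
  by (rule integrable_continuous_interval) (use continuous continuous_on_subset in blast)

lemma mono: "a \<le> b \<Longrightarrow> h a \<le> h b"
  using strict_mono by (simp add: strict_mono_less_eq)

lemma nonneg: "t \<ge> 0 \<Longrightarrow> h t \<ge> 0"
  using mono[of 0 t] zero by simp

lemma h_abs: "h \<bar>t\<bar> = \<bar>h t\<bar>"
  using nonneg[of t] nonneg[of "-t"] odd[of t] by (cases "t \<ge> 0") auto

lemma H_abs [simp]: "H \<bar>t\<bar> = H t"
  by (simp add: H_def)

lemma h_times: "h t * t = h \<bar>t\<bar> * \<bar>t\<bar>"
  using odd[of t] by (cases "t \<ge> 0") auto

lemma H_zero [simp]: "H 0 = 0"
  by (simp add: H_def)

lemma H_nonneg: "H t \<ge> 0"
  unfolding H_def by (rule integral_nonneg) (use integrable nonneg in auto)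

lemma H_mono: "\<bar>a\<bar> \<le> \<bar>b\<bar> \<Longrightarrow> H a \<le> H b"
  unfolding H_def by (rule integral_subset_le) (use integrable nonneg in auto)

text \<open>Comparing \<open>h\<close> with its end value \<open>h b\<close> on the interval between
  the two points yields the subgradient inequality at \<open>b\<close>, that is, convexity, without
  differentiating \<open>H\<close>.\<close>

lemma H_tangent_nonneg:
  assumes "a \<ge> 0" "b \<ge> 0"
  shows "H b - H a \<le> h b * (b - a)"
proof (cases "a \<le> b")
  case True
  have "integral {0..a} h + integral {a..b} h = integral {0..b} h"
    by (rule Henstock_Kurzweil_Integration.integral_combine[OF assms(1) True integrable])
  moreover have "integral {a..b} h \<le> integral {a..b} (\<lambda>_. h b)"
    by (rule integral_le) (use integrable mono in auto)
  ultimately show ?thesis using assms True by (simp add: H_def algebra_simps)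
next
  case False
  then have ba: "b \<le> a" by simp
  have "integral {0..b} h + integral {b..a} h = integral {0..a} h"
    by (rule Henstock_Kurzweil_Integration.integral_combine[OF assms(2) ba integrable])
  moreover have "integral {b..a} (\<lambda>_. h b) \<le> integral {b..a} h"
    by (rule integral_le) (use integrable mono in auto)
  ultimately show ?thesis using assms ba by (simp add: H_def algebra_simps)
qed

text \<open>By oddness \<open>h b * b\<close> depends only on absolute values, and replacing
  \<open>\<bar>h b\<bar> * \<bar>a\<bar>\<close> by \<open>h b * a\<close> only enlarges the bound,
  so the half-line case suffices.\<close>

lemma H_tangent: "H b - H a \<le> h b * (b - a)"
proof -
  have "H b - H a \<le> h \<bar>b\<bar> * (\<bar>b\<bar> - \<bar>a\<bar>)"
    using H_tangent_nonneg[of "\<bar>a\<bar>" "\<bar>b\<bar>"] by simp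
  also have "\<dots> = h b * b - \<bar>h b\<bar> * \<bar>a\<bar>"
    using h_times[of b] h_abs[of b] by (simp add: algebra_simps)
  also have "\<dots> \<le> h b * b - h b * a"
    by (simp add: abs_mult[symmetric])
  finally show ?thesis by (simp add: algebra_simps)
qed

text \<open>The tangent at the midpoint lies below \<open>H\<close> at both ends; in the sum of the
  two inequalities the slope terms cancel.\<close>

lemma H_midpoint: "H ((a + b) / 2) \<le> (H a + H b) / 2"
proof -
  have "h ((a + b) / 2) * ((a + b) / 2 - a) + h ((a + b) / 2) * ((a + b) / 2 - b) = 0"
    by (simp add: field_simps)
  with H_tangent[of "(a + b) / 2" a] H_tangent[of "(a + b) / 2" b] show ?thesis by argo
qed

lemma isCont_h: "isCont h t"
  using continuous by (simp add: continuous_on_eq_continuous_at)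

text \<open>Increments of \<open>H\<close> are squeezed between tangents with slopes
  \<open>h t\<close> and \<open>h b\<close>, both of which vanish as \<open>b\<close> tends to
  \<open>t\<close>.\<close>

lemma isCont_H: "isCont H t"
proof -
  have lower: "((\<lambda>b. h t * (b - t)) \<longlongrightarrow> h t * (t - t)) (at t)"
    by (intro tendsto_intros)
  have upper: "((\<lambda>b. h b * (b - t)) \<longlongrightarrow> h t * (t - t)) (at t)"
    using isCont_h[of t] by (intro tendsto_intros) (simp add: isCont_def)
  have le: "h t * (b - t) \<le> H b - H t" for b
    using H_tangent[of t b] by (simp add: algebra_simps)
  have "((\<lambda>b. H b - H t) \<longlongrightarrow> h t * (t - t)) (at t)"
    by (rule tendsto_sandwich[OF _ _ lower upper]) (simp_all add: le H_tangent)
  then show ?thesis by (simp add: isCont_def LIM_zero_iff)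
qed

text \<open>Nonnegative values come from the intermediate value theorem, negative ones from oddness.
  Surjectivity makes \<open>inv h\<close> a two-sided inverse, so growth bounds can be moved between
  \<open>inv h\<close> and \<open>h\<close>.\<close>

lemma surj: "surj h"
proof (rule surjI[where f = "\<lambda>y. SOME x. h x = y"])
  fix y :: real
  have *: "\<exists>x. h x = y" if y: "y \<ge> 0" for y
  proof -
    from at_top obtain b where b: "\<And>x. x \<ge> b \<Longrightarrow> h x \<ge> y"
      unfolding filterlim_at_top eventually_at_top_linorder by blast
    have "h (max 0 b) \<ge> y" using b by simp
    then have "\<exists>x\<ge>0. x \<le> max 0 b \<and> h x = y"
      by (intro IVT') (use y zero continuous_on_subset[OF continuous] in auto)
    then show ?thesis by blast
  qed
  have "\<exists>x. h x = y"
    using *[of y] *[of "-y"] odd by (cases "y \<ge> 0") (auto, metis minus_minus)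
  then show "h (SOME x. h x = y) = y" by (rule someI_ex)
qed

lemma inv_h [simp]: "inv h (h t) = t"
  by (rule inv_f_f) (use strict_mono strict_mono_imp_inj_on in blast)

lemma h_inv [simp]: "h (inv h t) = t"
  by (rule surj_f_inv_f[OF surj])

lemma mono_inv: "mono (inv h)"
  by (rule strict_mono_mono[OF strict_mono_inv[OF strict_mono surj inv_h]])

lemma inv_zero: "inv h 0 = 0"
  using inv_h[of 0] zero by simp

end

locale Delta2_function = odd_increasing +
  fixes c1 c2 :: real
  assumes c1: "0 < c1" "c1 \<le> 1" and c2: "0 < c2" "c2 \<le> 1"
    and Delta2: "t \<ge> 0 \<Longrightarrow> c1 * (t * h t) \<le> H t"
    and upper: "t \<ge> 0 \<Longrightarrow> H t \<le> t * h t"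
    and Delta2_inv: "t \<ge> 0 \<Longrightarrow> c2 * (t * inv h t) \<le> integral {0..t} (inv h)"
    and upper_inv: "t \<ge> 0 \<Longrightarrow> integral {0..t} (inv h) \<le> t * inv h t"
begin

text \<open>A substitute for Young's inequality that avoids the conjugate function: both arguments
  are replaced by the larger one in absolute value, where \<open>t * h t\<close> is comparable to
  \<open>H t\<close>.\<close>

lemma h_times_le: "\<bar>h a * b\<bar> \<le> (H a + H b) / c1"
proof -
  define m where "m = max \<bar>a\<bar> \<bar>b\<bar>"
  have "H m = H a \<or> H m = H b" unfolding m_def by (auto simp: max_def)
  then have m: "H m \<le> H a + H b" using H_nonneg[of a] H_nonneg[of b] by auto
  have "\<bar>h a * b\<bar> = h \<bar>a\<bar> * \<bar>b\<bar>" by (simp add: abs_mult h_abs)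
  also have "\<dots> \<le> h m * m"
    by (rule mult_mono) (auto simp: m_def nonneg intro!: mono)
  also have "\<dots> \<le> H m / c1"
    using Delta2[of m] c1 by (simp add: m_def field_simps)
  also have "\<dots> \<le> (H a + H b) / c1" using m c1 by (simp add: divide_right_mono)
  finally show ?thesis .
qed

end

text \<open>Since \<open>K\<close> is fixed before \<open>h\<close> and \<open>c2\<close>, one
  constant serves almost every fibre. Evenness of \<open>H\<close> reduces a negative
  \<open>L\<close> to its absolute value.\<close>

lemma Delta2_function_growth:
  assumes "0 < c1" "c1 \<le> 1"
  obtains K where "K \<ge> 1"
    and "\<And>h c2 t. Delta2_function h c1 c2 \<Longrightarrow> odd_increasing.H h (L * t) \<le> K * odd_increasing.H h t"
proof -
  obtain K where K: "K \<ge> 1"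
    "\<And>h t. mono h \<Longrightarrow> h 0 = 0 \<Longrightarrow> (\<And>t. t \<ge> 0 \<Longrightarrow> c1 * (t * h t) \<le> integral {0..t} h) \<Longrightarrow> t \<ge> 0
           \<Longrightarrow> integral {0..\<bar>L\<bar> * t} h \<le> K * integral {0..t} h"
    using primitive_growth[OF assms, of "\<bar>L\<bar>"] by metis
  show thesis
  proof
    fix h c2 t assume "Delta2_function h c1 c2"
    then interpret Delta2_function h c1 c2 .
    have "integral {0..\<bar>L\<bar> * \<bar>t\<bar>} h \<le> K * integral {0..\<bar>t\<bar>} h"
      by (rule K(2)) (use zero mono Delta2 in \<open>auto simp: H_def mono_def\<close>)
    then show "H (L * t) \<le> K * H t" by (simp add: H_def abs_mult)
  qed (rule K)
qed

text \<open>Growth of the inverse turns into superlinearity: \<open>h\<^sup>-\<^sup>1 (\<lambda> \<tau>) \<le> \<mu> h\<^sup>-\<^sup>1 \<tau>\<close> reads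
  \<open>\<lambda> h t \<le> h (\<mu> t)\<close>.\<close>

lemma Delta2_function_superlinear:
  assumes c1: "0 < c1" "c1 \<le> 1" and c2: "0 < c2" "c2 \<le> 1"
  obtains \<mu>0 where "\<mu>0 > 0"
    and "\<And>h t \<mu>. Delta2_function h c1 c2 \<Longrightarrow> \<mu> \<ge> \<mu>0
           \<Longrightarrow> L * \<mu> * odd_increasing.H h (t / \<mu>) \<le> odd_increasing.H h t"
proof -
  \<comment> \<open>The quotient by \<open>c1\<close> compensates the loss when
    \<open>t * h t\<close> is replaced by \<open>H t\<close> at the end.\<close>
  define l where "l = max 1 (L / c1)"
  have l: "l > 0" "l \<ge> 1" "L \<le> c1 * l"  using c1 by (auto simp: l_def field_simps max_def)
  obtain K where K: "K \<ge> 1"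
    "\<And>h t. mono h \<Longrightarrow> h 0 = 0 \<Longrightarrow> (\<And>t. t \<ge> 0 \<Longrightarrow> c2 * (t * h t) \<le> integral {0..t} h) \<Longrightarrow> t \<ge> 0
           \<Longrightarrow> integral {0..l * t} h \<le> K * integral {0..t} h"
    using primitive_growth[OF c2, of l] by metis
  \<comment> \<open>This is the factor left over when
    \<open>c2 * (l * y) * inv h (l * y) \<le> K * y * inv h y\<close> is solved for
    \<open>inv h (l * y)\<close>.\<close>
  define \<mu>0 where "\<mu>0 = K / (c2 * l)"
  show thesis
  proof
    show \<mu>0: "\<mu>0 > 0" using K c2 l by (simp add: \<mu>0_def)
    fix h t \<mu> assume "Delta2_function h c1 c2" and \<mu>: "\<mu> \<ge> \<mu>0"
    then interpret Delta2_function h c1 c2 by simp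
    have inv_le: "inv h (l * y) \<le> \<mu>0 * inv h y" if y: "y \<ge> 0" for y
    proof (cases "y = 0")
      case False
      with y have y: "y > 0" by simp
      have "c2 * (l * y * inv h (l * y)) \<le> integral {0..l * y} (inv h)"
        using Delta2_inv[of "l * y"] y l by simp
      also have "\<dots> \<le> K * integral {0..y} (inv h)"
        by (rule K(2)) (use mono_inv inv_zero Delta2_inv y in auto)
      also have "\<dots> \<le> K * (y * inv h y)"
        using upper_inv[of y] K y by simp
      finally show ?thesis using y c2 l by (simp add: \<mu>0_def field_simps)
    qed (simp add: inv_zero)
    \<comment> \<open>The inverse bound is read at \<open>y = h \<tau>\<close> and \<open>h\<close>
      is applied to both sides.\<close>
    have h_le: "l * h \<tau> \<le> h (\<mu>0 * \<tau>)" if "\<tau> \<ge> 0" for \<tau>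
    proof -
      have "h (inv h (l * h \<tau>)) \<le> h (\<mu>0 * \<tau>)"
        using inv_le[of "h \<tau>"] nonneg[OF that] by (intro mono) simp
      then show ?thesis by simp
    qed
    define \<tau> where "\<tau> = \<bar>t\<bar> / \<mu>"
    have \<tau>: "\<tau> \<ge> 0" "\<mu> > 0" "\<mu> * \<tau> = \<bar>t\<bar>" using \<mu> \<mu>0 by (auto simp: \<tau>_def)
    have "L * \<mu> * H \<tau> \<le> (c1 * l) * \<mu> * H \<tau>"
      using l \<tau> H_nonneg by (intro mult_right_mono) auto
    also have "\<dots> \<le> (c1 * l) * \<mu> * (\<tau> * h \<tau>)"
      using upper[OF \<tau>(1)] c1 l \<tau> by (intro mult_left_mono) auto
    also have "\<dots> = c1 * (\<mu> * \<tau> * (l * h \<tau>))" by simp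
    also have "\<dots> \<le> c1 * (\<mu> * \<tau> * h (\<mu> * \<tau>))"
    proof -
      have "l * h \<tau> \<le> h (\<mu> * \<tau>)"
        using h_le[OF \<tau>(1)] mono[of "\<mu>0 * \<tau>" "\<mu> * \<tau>"] \<mu> \<tau> by (smt (verit) mult_right_mono)
      then show ?thesis using c1 \<tau> by (intro mult_left_mono) auto
    qed
    also have "\<dots> \<le> H (\<mu> * \<tau>)" using Delta2[of "\<mu> * \<tau>"] \<tau> by simp
    also have "\<dots> = H t" using \<tau> by simp
    also have "H \<tau> = H (t / \<mu>)" using \<tau> by (metis H_abs \<tau>_def abs_divide abs_of_pos)
    finally show "L * \<mu> * H (t / \<mu>) \<le> H t" .
  qed
qed

section \<open>Square-integrable functions on a bounded domain\<close>

lemma Fatou_bound: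
  fixes h :: "nat \<Rightarrow> 'a \<Rightarrow> real"
  assumes h: "\<And>k. integrable M (h k)" "\<And>k. AE x in M. h k x \<ge> 0"
    and g: "g \<in> borel_measurable M"
    and lim: "AE x in M. (\<lambda>k. h k x) \<longlonglongrightarrow> g x"
    and bound: "\<And>k. (LINT x|M. h k x) \<le> A"
  shows "integrable M g" and "(LINT x|M. g x) \<le> A"
proof -
  note [measurable] = h(1) g
  have nn: "AE x in M. \<forall>k. h k x \<ge> 0" using h(2) by (simp add: AE_all_countable)
  have A: "A \<ge> 0" using integral_nonneg_AE[OF h(2)[of 0]] bound[of 0] by linarith
  have g0: "AE x in M. g x \<ge> 0"
    using nn lim by eventually_elim (auto intro: LIMSEQ_le_const)
  have "(\<integral>\<^sup>+ x. ennreal (g x) \<partial>M) = (\<integral>\<^sup>+ x. liminf (\<lambda>k. ennreal (h k x)) \<partial>M)"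
  proof (rule nn_integral_cong_AE)
    show "AE x in M. ennreal (g x) = liminf (\<lambda>k. ennreal (h k x))"
      using lim by eventually_elim (metis lim_imp_Liminf tendsto_ennrealI sequentially_bot)
  qed
  also have "\<dots> \<le> liminf (\<lambda>k. \<integral>\<^sup>+ x. ennreal (h k x) \<partial>M)"
    by (rule nn_integral_liminf) measurable
  also have "\<dots> \<le> ennreal A"
  proof (rule Liminf_le)
    show "\<forall>\<^sub>F k in sequentially. (\<integral>\<^sup>+ x. ennreal (h k x) \<partial>M) \<le> ennreal A"
      using nn_integral_eq_integral[OF h] bound by (simp add: ennreal_leI)
  qed simp
  finally have le: "(\<integral>\<^sup>+ x. ennreal (g x) \<partial>M) \<le> ennreal A" .
  show int: "integrable M g"
    using le g0 ennreal_less_top[of A] by (intro integrableI_nonneg) (auto intro: le_less_trans)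
  show "(LINT x|M. g x) \<le> A"
    using le nn_integral_eq_integral[OF int g0] A by simp
qed

text \<open>After dropping finitely many terms the integrals stay below \<open>l + e\<close>, so the
  version with a uniform bound applies for every positive \<open>e\<close>.\<close>

lemma Fatou_limit:
  fixes h :: "nat \<Rightarrow> 'a \<Rightarrow> real"
  assumes h: "\<And>k. integrable M (h k)" "\<And>k. AE x in M. h k x \<ge> 0"
    and g: "g \<in> borel_measurable M"
    and lim: "AE x in M. (\<lambda>k. h k x) \<longlonglongrightarrow> g x"
    and int: "(\<lambda>k. LINT x|M. h k x) \<longlonglongrightarrow> l"
  shows "integrable M g" and "(LINT x|M. g x) \<le> l"
proof -
  have *: "integrable M g \<and> (LINT x|M. g x) \<le> l + e" if "e > 0" for e
  proof -
    have "\<forall>\<^sub>F k in sequentially. (LINT x|M. h k x) < l + e"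
      by (rule order_tendstoD(2)[OF int]) (use that in simp)
    then obtain N where N: "\<And>k. k \<ge> N \<Longrightarrow> (LINT x|M. h k x) < l + e"
      by (auto simp: eventually_sequentially)
    have lim': "AE x in M. (\<lambda>k. h (k + N) x) \<longlonglongrightarrow> g x"
      using lim by eventually_elim (rule LIMSEQ_ignore_initial_segment)
    have bound: "(LINT x|M. h (k + N) x) \<le> l + e" for k
      using N[of "k + N"] by simp
    show ?thesis
      using Fatou_bound[OF h g lim' bound] by blast
  qed
  show "integrable M g" using *[of 1] by simp
  show "(LINT x|M. g x) \<le> l" by (rule field_le_epsilon) (use * in blast)
qed

locale bounded_domain =
  fixes \<Omega> :: "'a::euclidean_space set"
  assumes open_domain: "open \<Omega>" and bounded_domain: "bounded \<Omega>"
begin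

abbreviation M :: "'a measure" where "M \<equiv> lebesgue_on \<Omega>"

sublocale finite_measure M
  by (rule finite_measure_lebesgue_on) (use open_domain bounded_domain lmeasurable_open in blast)

text \<open>Functions are not identified when they agree a.e., so this form is only semidefinite: a
  vanishing square means vanishing a.e.\<close>

definition ip :: "('a \<Rightarrow> real) \<Rightarrow> ('a \<Rightarrow> real) \<Rightarrow> real" where
  "ip u v = (LINT x|M. u x * v x)"

lemma L2_iff: "u \<in> L2 \<Omega> \<longleftrightarrow> u \<in> borel_measurable M \<and> integrable M (\<lambda>x. (u x)\<^sup>2)" for u :: "'a \<Rightarrow> real"
  by (simp add: L2_def)

lemma L2_norm_eq: "L2_norm \<Omega> u = sqrt (ip u u)" for u :: "'a \<Rightarrow> real"
  by (simp add: L2_norm_def ip_def power2_eq_square)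

lemma L2_mult_integrable:
  fixes u v :: "'a \<Rightarrow> real"
  assumes "u \<in> L2 \<Omega>" "v \<in> L2 \<Omega>"
  shows "integrable M (\<lambda>x. u x * v x)"
proof (rule Bochner_Integration.integrable_bound)
  show "integrable M (\<lambda>x. (u x)\<^sup>2 + (v x)\<^sup>2)" using assms by (simp add: L2_iff)
  show "(\<lambda>x. u x * v x) \<in> borel_measurable M"
    using assms by (intro borel_measurable_times) (auto simp: L2_iff)
  have "\<bar>a * b\<bar> \<le> a\<^sup>2 + b\<^sup>2" for a b :: real
    using sum_squares_bound[of "\<bar>a\<bar>" "\<bar>b\<bar>"] abs_ge_zero[of "a * b"]
    unfolding abs_mult power2_abs by linarith
  then show "AE x in M. norm (u x * v x) \<le> norm ((u x)\<^sup>2 + (v x)\<^sup>2)" by simp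
qed

lemma L2_cmult [intro]: "u \<in> L2 \<Omega> \<Longrightarrow> (\<lambda>x. c * u x) \<in> L2 \<Omega>" for u :: "'a \<Rightarrow> real"
  by (auto simp: L2_iff power_mult_distrib)

lemma L2_add [intro]:
  fixes u v :: "'a \<Rightarrow> real"
  assumes "u \<in> L2 \<Omega>" "v \<in> L2 \<Omega>"
  shows "(\<lambda>x. u x + v x) \<in> L2 \<Omega>"
  using assms L2_mult_integrable[OF assms] by (auto simp: L2_iff power2_sum mult.assoc)

lemma L2_diff [intro]: "u \<in> L2 \<Omega> \<Longrightarrow> v \<in> L2 \<Omega> \<Longrightarrow> (\<lambda>x. u x - v x) \<in> L2 \<Omega>" for u v :: "'a \<Rightarrow> real"
  using L2_add[of u "\<lambda>x. (-1) * v x"] L2_cmult[of v "-1"] by simp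

lemma L2_sum [intro]:
  fixes u :: "'i \<Rightarrow> 'a \<Rightarrow> real"
  shows "(\<And>i. i \<in> I \<Longrightarrow> u i \<in> L2 \<Omega>) \<Longrightarrow> (\<lambda>x. \<Sum>i\<in>I. u i x) \<in> L2 \<Omega>"
proof (induction I rule: infinite_finite_induct)
  case (insert i I) then show ?case using L2_add by (simp add: insert)
qed (simp_all add: L2_iff)

lemma ip_commute: "ip u v = ip v u"
  by (simp add: ip_def mult.commute)

lemma ip_cmult: "ip (\<lambda>x. c * u x) v = c * ip u v"
  by (simp add: ip_def mult.assoc)

lemma ip_add: "u \<in> L2 \<Omega> \<Longrightarrow> v \<in> L2 \<Omega> \<Longrightarrow> w \<in> L2 \<Omega> \<Longrightarrow> ip (\<lambda>x. u x + v x) w = ip u w + ip v w"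
  by (simp add: ip_def distrib_right L2_mult_integrable)

lemma ip_diff: "u \<in> L2 \<Omega> \<Longrightarrow> v \<in> L2 \<Omega> \<Longrightarrow> w \<in> L2 \<Omega> \<Longrightarrow> ip (\<lambda>x. u x - v x) w = ip u w - ip v w"
  by (simp add: ip_def left_diff_distrib L2_mult_integrable)

lemma ip_sum:
  assumes "\<And>i. i \<in> I \<Longrightarrow> u i \<in> L2 \<Omega>" "w \<in> L2 \<Omega>"
  shows "ip (\<lambda>x. \<Sum>i\<in>I. u i x) w = (\<Sum>i\<in>I. ip (u i) w)"
  using assms by (simp add: ip_def sum_distrib_right L2_mult_integrable)

lemma ip_self_nonneg: "ip u u \<ge> 0"
  by (simp add: ip_def)

lemma ip_Cauchy_Schwarz:
  assumes u: "u \<in> L2 \<Omega>" and v: "v \<in> L2 \<Omega>"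
  shows "\<bar>ip u v\<bar> \<le> sqrt (ip u u) * sqrt (ip v v)"
proof -
  have quad: "0 \<le> ip u u - 2 * t * ip u v + t\<^sup>2 * ip v v" for t
  proof -
    have tv: "(\<lambda>x. t * v x) \<in> L2 \<Omega>" using v by (rule L2_cmult)
    have "0 \<le> ip (\<lambda>x. u x - t * v x) (\<lambda>x. u x - t * v x)" by (rule ip_self_nonneg)
    also have "\<dots> = ip (\<lambda>x. u x - t * v x) u - t * ip (\<lambda>x. u x - t * v x) v"
      using ip_diff[OF u tv L2_diff[OF u tv]]
      by (simp only: ip_cmult ip_commute[of u "\<lambda>x. u x - t * v x"] ip_commute[of v "\<lambda>x. u x - t * v x"])
    also have "\<dots> = ip u u - 2 * t * ip u v + t\<^sup>2 * ip v v"
      by (simp only: ip_diff[OF u tv u] ip_diff[OF u tv v] ip_cmult ip_commute[of v u])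
         (simp add: power2_eq_square algebra_simps)
    finally show ?thesis .
  qed
  have "(ip u v)\<^sup>2 \<le> ip u u * ip v v"
  proof (cases "ip v v = 0")
    case True
    have "ip u v = 0"
    proof (rule ccontr)
      assume "ip u v \<noteq> 0"
      \<comment> \<open>With \<open>ip v v = 0\<close> the quadratic is affine in \<open>t\<close>,
        and at this \<open>t\<close> its value is -1.\<close>
      then show False using quad[of "(ip u u + 1) / (2 * ip u v)"] True by simp
    qed
    then show ?thesis using True by simp
  next
    case False
    then have "ip v v > 0" using ip_self_nonneg[of v] by simp
    then show ?thesis
      using quad[of "ip u v / ip v v"] by (simp add: field_simps power2_eq_square)
  qed
  then have "sqrt ((ip u v)\<^sup>2) \<le> sqrt (ip u u * ip v v)" by (rule real_sqrt_le_mono)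
  then show ?thesis by (simp add: real_sqrt_mult)
qed

text \<open>Norm convergence implies weak convergence, by Cauchy-Schwarz applied to the
  differences.\<close>

lemma ip_tendsto:
  assumes U: "\<And>k. U k \<in> L2 \<Omega>" and u: "u \<in> L2 \<Omega>" and v: "v \<in> L2 \<Omega>"
    and lim: "(\<lambda>k. ip (\<lambda>x. U k x - u x) (\<lambda>x. U k x - u x)) \<longlonglongrightarrow> 0"
  shows "(\<lambda>k. ip (U k) v) \<longlonglongrightarrow> ip u v"
proof (rule LIM_zero_cancel, rule Lim_null_comparison)
  show "\<forall>\<^sub>F k in sequentially. norm (ip (U k) v - ip u v)
          \<le> sqrt (ip (\<lambda>x. U k x - u x) (\<lambda>x. U k x - u x)) * sqrt (ip v v)"
    using ip_Cauchy_Schwarz[OF L2_diff[OF U u] v] ip_diff[OF U u v] by simp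
  show "(\<lambda>k. sqrt (ip (\<lambda>x. U k x - u x) (\<lambda>x. U k x - u x)) * sqrt (ip v v)) \<longlonglongrightarrow> 0"
    using tendsto_mult[OF tendsto_real_sqrt[OF lim] tendsto_const] by simp
qed

lemma ip_self_eq_0_imp_AE:
  assumes "u \<in> L2 \<Omega>" "ip u u = 0"
  shows "AE x in M. u x = 0"
  using assms integral_nonneg_eq_0_iff_AE[of M "\<lambda>x. (u x)\<^sup>2"]
  by (auto simp: ip_def L2_iff power2_eq_square)

text \<open>Riesz--Fischer. Since the measure is finite, \<open>L\<^sup>2\<close>-distances dominate \<open>L\<^sup>1\<close>-distances, and a
  rapidly Cauchy subsequence converges a.e.\<close>

lemma L2_complete:
  fixes U :: "nat \<Rightarrow> 'a \<Rightarrow> real"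
  assumes U: "\<And>n. U n \<in> L2 \<Omega>"
    and Cauchy: "\<And>e. e > 0 \<Longrightarrow> \<exists>N. \<forall>m\<ge>N. \<forall>n\<ge>N. ip (\<lambda>x. U m x - U n x) (\<lambda>x. U m x - U n x) \<le> e"
  obtains u r where "u \<in> L2 \<Omega>" "strict_mono r" "AE x in M. (\<lambda>k. U (r k) x) \<longlonglongrightarrow> u x"
    "(\<lambda>n. ip (\<lambda>x. U n x - u x) (\<lambda>x. U n x - u x)) \<longlonglongrightarrow> 0"
proof -
  have Um [measurable]: "U n \<in> borel_measurable M" for n using U[of n] by (simp add: L2_iff)
  \<comment> \<open>The bound is on squared distances; its square root \<open>(1/2)^k\<close> is
    summable.\<close>
  have "\<forall>k::nat. \<exists>N. \<forall>m\<ge>N. \<forall>n\<ge>N. ip (\<lambda>x. U m x - U n x) (\<lambda>x. U m x - U n x) \<le> (1/4)^k"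
    by (intro allI Cauchy) simp
  then obtain N where N: "\<And>k m n. m \<ge> N k \<Longrightarrow> n \<ge> N k
      \<Longrightarrow> ip (\<lambda>x. U m x - U n x) (\<lambda>x. U m x - U n x) \<le> (1/4)^k"
    by metis
  \<comment> \<open>Summing successors makes the indices strictly increasing while still exceeding
    each \<open>N k\<close>.\<close>
  define r where "r k = (\<Sum>i\<le>k. Suc (N i))" for k
  have r: "strict_mono r" by (rule strict_monoI_Suc) (simp add: r_def)
  have rN: "N k \<le> r k" for k
    using member_le_sum[of k "{..k}" "\<lambda>i. Suc (N i)"] by (simp add: r_def)
  define d where "d k x = U (r (Suc k)) x - U (r k) x" for k x
  have d: "d k \<in> L2 \<Omega>" for k unfolding d_def using U by auto
  have dm [measurable]: "d k \<in> borel_measurable M" for k using d by (simp add: L2_iff)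
  have dL1: "(LINT x|M. \<bar>d k x\<bar>) \<le> sqrt (measure M \<Omega>) * (1/2)^k" and dint: "integrable M (\<lambda>x. \<bar>d k x\<bar>)" for k
  proof -
    have abs: "(\<lambda>x. \<bar>d k x\<bar>) \<in> L2 \<Omega>" and one: "(\<lambda>x. 1::real) \<in> L2 \<Omega>"
      using d[of k] by (auto simp: L2_iff)
    show "integrable M (\<lambda>x. \<bar>d k x\<bar>)" using L2_mult_integrable[OF abs one] by simp
    have "(LINT x|M. \<bar>d k x\<bar>) \<le> \<bar>ip (\<lambda>x. \<bar>d k x\<bar>) (\<lambda>x. 1)\<bar>" by (simp add: ip_def)
    also have "\<dots> \<le> sqrt (ip (d k) (d k)) * sqrt (measure M \<Omega>)"
      using ip_Cauchy_Schwarz[OF abs one] by (simp add: ip_def)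
    also have "sqrt (ip (d k) (d k)) \<le> sqrt ((1/4)^k)"
      unfolding d_def using rN[of k] strict_mono_less_eq[OF r, of k "Suc k"]
      by (intro real_sqrt_le_mono N) auto
    also have "sqrt ((1/4)^k) = (1/2::real)^k"
      by (simp add: real_sqrt_power real_sqrt_divide)
    finally show "(LINT x|M. \<bar>d k x\<bar>) \<le> sqrt (measure M \<Omega>) * (1/2)^k"
      by (simp add: mult.commute mult_right_mono)
  qed
  \<comment> \<open>The sum of the \<open>d k\<close> in absolute value has finite integral, hence
    is finite a.e.; telescoping then gives convergence of the subsequence.\<close>
  have "AE x in M. summable (\<lambda>k. \<bar>d k x\<bar>)"
  proof -
    have "(\<integral>\<^sup>+ x. (\<Sum>k. ennreal \<bar>d k x\<bar>) \<partial>M) = (\<Sum>k. \<integral>\<^sup>+ x. ennreal \<bar>d k x\<bar> \<partial>M)"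
      by (rule nn_integral_suminf) measurable
    also have "\<dots> = (\<Sum>k. ennreal (LINT x|M. \<bar>d k x\<bar>))"
      by (intro suminf_cong nn_integral_eq_integral[OF dint]) simp
    also have "\<dots> \<le> (\<Sum>k. ennreal (sqrt (measure M \<Omega>) * (1/2)^k))"
      by (intro suminf_le ennreal_leI dL1) auto
    also have "\<dots> = ennreal (\<Sum>k. sqrt (measure M \<Omega>) * (1/2)^k)"
      by (intro suminf_ennreal2 summable_mult summable_geometric) auto
    finally have "(\<integral>\<^sup>+ x. (\<Sum>k. ennreal \<bar>d k x\<bar>) \<partial>M) \<noteq> \<infinity>"
      by (auto simp: top_unique)
    then have "AE x in M. (\<Sum>k. ennreal \<bar>d k x\<bar>) \<noteq> \<infinity>"
      by (intro nn_integral_PInf_AE) measurable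
    then show ?thesis by eventually_elim (rule summable_suminf_not_top, auto)
  qed
  then have conv: "AE x in M. convergent (\<lambda>k. U (r k) x)"
  proof eventually_elim
    case (elim x)
    then have "summable (\<lambda>k. d k x)" by (simp add: summable_rabs_cancel)
    then have "convergent (\<lambda>n. \<Sum>k<n. d k x)" by (simp add: summable_iff_convergent)
    then have "convergent (\<lambda>n. U (r n) x - U (r 0) x)"
      by (simp only: d_def sum_lessThan_telescope[of "\<lambda>n. U (r n) x"])
    then have "convergent (\<lambda>n. (U (r n) x - U (r 0) x) + U (r 0) x)"
      by (intro convergent_add convergent_const)
    then show ?case by simp
  qed
  define u where "u x = lim (\<lambda>k. U (r k) x)" for x
  have um [measurable]: "u \<in> borel_measurable M" unfolding u_def by measurable
  have AE: "AE x in M. (\<lambda>k. U (r k) x) \<longlonglongrightarrow> u x"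
    using conv by eventually_elim (simp add: u_def convergent_LIMSEQ_iff)
  have close: "\<exists>N. \<forall>n\<ge>N. integrable M (\<lambda>x. (U n x - u x)\<^sup>2) \<and> (LINT x|M. (U n x - u x)\<^sup>2) \<le> e"
    if "e > 0" for e
  proof -
    from Cauchy[OF that] obtain N where
      N: "\<And>m n. m \<ge> N \<Longrightarrow> n \<ge> N \<Longrightarrow> ip (\<lambda>x. U m x - U n x) (\<lambda>x. U m x - U n x) \<le> e" by blast
    have "integrable M (\<lambda>x. (U n x - u x)\<^sup>2) \<and> (LINT x|M. (U n x - u x)\<^sup>2) \<le> e" if "n \<ge> N" for n
    proof -
      \<comment> \<open>Fatou along the subsequence, with \<open>n\<close> fixed, carries the Cauchy
        bound over to the limit. This yields convergence of the whole sequence and also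
        \<open>u \<in> L2 \<Omega>\<close>.\<close>
      let ?h = "\<lambda>k x. (U n x - U (r (k + N)) x)\<^sup>2"
      have h: "integrable M (?h k)" for k using L2_diff[OF U U] by (simp add: L2_iff)
      have lim: "AE x in M. (\<lambda>k. ?h k x) \<longlonglongrightarrow> (U n x - u x)\<^sup>2"
        using AE by eventually_elim (intro tendsto_intros LIMSEQ_ignore_initial_segment)
      have bound: "(LINT x|M. ?h k x) \<le> e" for k
        using N[of n "r (k + N)"] that seq_suble[OF r, of "k + N"] by (simp add: ip_def power2_eq_square)
      show ?thesis using Fatou_bound[OF h _ _ lim bound] by simp
    qed
    then show ?thesis by blast
  qed
  from close[of 1] obtain N where "integrable M (\<lambda>x. (U N x - u x)\<^sup>2)" by auto
  then have "(\<lambda>x. U N x - u x) \<in> L2 \<Omega>" by (simp add: L2_iff)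
  from L2_diff[OF U[of N] this] have u: "u \<in> L2 \<Omega>" by simp
  have "(\<lambda>n. ip (\<lambda>x. U n x - u x) (\<lambda>x. U n x - u x)) \<longlonglongrightarrow> 0"
  proof (rule LIMSEQ_I)
    fix e :: real assume "e > 0"
    then obtain N where "\<And>n. n \<ge> N \<Longrightarrow> (LINT x|M. (U n x - u x)\<^sup>2) \<le> e / 2"
      using close[of "e / 2"] by auto
    with \<open>e > 0\<close> have "norm (ip (\<lambda>x. U n x - u x) (\<lambda>x. U n x - u x) - 0) < e" if "n \<ge> N" for n
      using that ip_self_nonneg[of "\<lambda>x. U n x - u x"] by (force simp: ip_def power2_eq_square)
    then show "\<exists>N. \<forall>n\<ge>N. norm (ip (\<lambda>x. U n x - u x) (\<lambda>x. U n x - u x) - 0) < e" by blast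
  qed
  with u r AE show thesis by (rule that)
qed

end

section \<open>The spectral energy form\<close>

locale dirichlet_spectrum = bounded_domain \<Omega> for \<Omega> :: "'a::euclidean_space set" +
  fixes \<Lambda> :: "nat \<Rightarrow> real" and \<phi> :: "nat \<Rightarrow> 'a \<Rightarrow> real" and s :: real
  assumes eigensystem: "dirichlet_eigensystem \<Omega> \<Lambda> \<phi>" and s_pos: "0 < s"
begin

section \<open>Expansion in eigenfunctions\<close>

abbreviation coeff :: "('a \<Rightarrow> real) \<Rightarrow> nat \<Rightarrow> real" where "coeff \<equiv> fourier_coeff \<Omega> \<phi>"

lemma coeff_eq: "coeff u n = ip u (\<phi> n)"
  by (simp add: fourier_coeff_def ip_def)

lemma eigenfunction_L2: "\<phi> n \<in> L2 \<Omega>"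
  using eigensystem by (auto simp: dirichlet_eigensystem_def neg_dirichlet_laplacian_def H10_def H1_def)

lemma orthonormal: "ip (\<phi> m) (\<phi> n) = (if m = n then 1 else 0)"
  using eigensystem by (auto simp: dirichlet_eigensystem_def ip_def)

lemma eigenvalue_bounds: "0 < \<Lambda> 0" "\<Lambda> 0 \<le> \<Lambda> n" "0 < \<Lambda> n"
proof -
  show "0 < \<Lambda> 0" "\<Lambda> 0 \<le> \<Lambda> n"
    using eigensystem by (auto simp: dirichlet_eigensystem_def mono_def)
  then show "0 < \<Lambda> n" by simp
qed

lemma expansion: "u \<in> L2 \<Omega> \<Longrightarrow> L2_sums \<Omega> (\<lambda>n x. coeff u n * \<phi> n x) u"
  using eigensystem by (auto simp: dirichlet_eigensystem_def)

lemma L2_sums_iff: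
  "L2_sums \<Omega> h w \<longleftrightarrow> w \<in> L2 \<Omega> \<and>
     (\<lambda>k. ip (\<lambda>x. (\<Sum>n<k. h n x) - w x) (\<lambda>x. (\<Sum>n<k. h n x) - w x)) \<longlonglongrightarrow> 0"
proof -
  have "(\<lambda>k. sqrt (a k)) \<longlonglongrightarrow> 0 \<longleftrightarrow> a \<longlonglongrightarrow> 0" if "\<And>k. a k \<ge> 0" for a :: "nat \<Rightarrow> real"
    using tendsto_real_sqrt[of a 0 sequentially] tendsto_power[of "\<lambda>k. sqrt (a k)" 0 sequentially 2] that
    by auto
  then show ?thesis by (simp add: L2_sums_def L2_norm_eq ip_self_nonneg)
qed

lemma L2_sums_ip:
  assumes "\<And>n. h n \<in> L2 \<Omega>" "L2_sums \<Omega> h w" "v \<in> L2 \<Omega>"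
  shows "(\<lambda>n. ip (h n) v) sums ip w v"
  unfolding sums_def using assms ip_tendsto[of "\<lambda>k x. \<Sum>n<k. h n x" w v]
  by (simp add: L2_sums_iff ip_sum L2_sum)

lemma Parseval:
  assumes "u \<in> L2 \<Omega>" "v \<in> L2 \<Omega>"
  shows "(\<lambda>n. coeff u n * coeff v n) sums ip u v"
  using L2_sums_ip[OF L2_cmult[OF eigenfunction_L2] expansion[OF assms(1)] assms(2)]
  by (simp add: ip_cmult coeff_eq[of v] ip_commute[of v])

text \<open>Pairing with \<open>\<phi> n\<close> leaves a single term of the series. Hence a
  representative picked by choice has prescribed coefficients.\<close>

lemma L2_sums_coeff:
  assumes "L2_sums \<Omega> (\<lambda>n x. a n * \<phi> n x) w"
  shows "coeff w n = a n"
proof -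
  have "(\<lambda>m. ip (\<lambda>x. a m * \<phi> m x) (\<phi> n)) sums ip w (\<phi> n)"
    by (rule L2_sums_ip[OF L2_cmult[OF eigenfunction_L2] assms eigenfunction_L2])
  moreover have "(\<lambda>m. ip (\<lambda>x. a m * \<phi> m x) (\<phi> n)) = (\<lambda>m. if m = n then a m else 0)"
    by (auto simp: ip_cmult orthonormal)
  ultimately show ?thesis
    using sums_single[of n a] sums_unique2 by (fastforce simp: coeff_eq)
qed

lemma ip_orthogonal_sum:
  assumes "finite I"
  shows "ip (\<lambda>x. \<Sum>i\<in>I. a i * \<phi> i x) (\<lambda>x. \<Sum>i\<in>I. a i * \<phi> i x) = (\<Sum>i\<in>I. (a i)\<^sup>2)"
proof -
  have L2: "(\<lambda>x. \<Sum>i\<in>I. a i * \<phi> i x) \<in> L2 \<Omega>"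
    by (intro L2_sum L2_cmult eigenfunction_L2)
  have coeff: "ip (\<phi> j) (\<lambda>x. \<Sum>i\<in>I. a i * \<phi> i x) = a j" if "j \<in> I" for j
    using that assms
    by (subst ip_commute, subst ip_sum)
       (auto simp: L2_cmult eigenfunction_L2 ip_cmult orthonormal if_distrib cong: if_cong)
  show ?thesis
    by (subst ip_sum) (auto simp: L2 L2_cmult eigenfunction_L2 ip_cmult coeff power2_eq_square)
qed

text \<open>By orthogonality the squared distance of two partial sums of the series is a difference
  of partial sums of the squared coefficients, so completeness applies. This justifies the choice
  operator in \<open>frac_laplacian\<close>.\<close>

lemma L2_sums_exists:
  assumes "summable (\<lambda>n. (a n)\<^sup>2)"
  shows "\<exists>w. L2_sums \<Omega> (\<lambda>n x. a n * \<phi> n x) w"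
proof -
  let ?S = "\<lambda>k x. \<Sum>n<k. a n * \<phi> n x"
  have S: "?S k \<in> L2 \<Omega>" for k by (intro L2_sum L2_cmult eigenfunction_L2)
  have diff: "ip (\<lambda>x. ?S m x - ?S n x) (\<lambda>x. ?S m x - ?S n x) = \<bar>(\<Sum>i<m. (a i)\<^sup>2) - (\<Sum>i<n. (a i)\<^sup>2)\<bar>"
    if "n \<le> m" for m n
  proof -
    have split: "(\<Sum>i<m. f i) - (\<Sum>i<n. f i) = (\<Sum>i\<in>{n..<m}. f i)" for f :: "nat \<Rightarrow> real"
      using sum_diff_nat_ivl[of 0 n m f] that by (simp add: atLeast0LessThan)
    show ?thesis
      by (simp add: split ip_orthogonal_sum sum_nonneg)
  qed
  have sym: "ip (\<lambda>x. ?S m x - ?S n x) (\<lambda>x. ?S m x - ?S n x)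
               = ip (\<lambda>x. ?S n x - ?S m x) (\<lambda>x. ?S n x - ?S m x)" for m n
    by (simp add: ip_def algebra_simps)
  have "\<exists>N. \<forall>m\<ge>N. \<forall>n\<ge>N. ip (\<lambda>x. ?S m x - ?S n x) (\<lambda>x. ?S m x - ?S n x) \<le> e" if e: "e > 0" for e
  proof -
    have "Cauchy (\<lambda>k. \<Sum>i<k. (a i)\<^sup>2)"
      using assms by (simp add: summable_iff_convergent Cauchy_convergent_iff)
    then obtain N where N: "\<And>m n. m \<ge> N \<Longrightarrow> n \<ge> N \<Longrightarrow> \<bar>(\<Sum>i<m. (a i)\<^sup>2) - (\<Sum>i<n. (a i)\<^sup>2)\<bar> < e"
      using e unfolding Cauchy_def dist_real_def by blast
    have "ip (\<lambda>x. ?S m x - ?S n x) (\<lambda>x. ?S m x - ?S n x) \<le> e" if "m \<ge> N" "n \<ge> N" for m n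
      using diff[of n m] diff[of m n] sym[of m n] N[of m n] N[of n m] that
      by (cases "n \<le> m") auto
    then show ?thesis by blast
  qed
  then obtain w where
    "w \<in> L2 \<Omega>" "(\<lambda>k. ip (\<lambda>x. ?S k x - w x) (\<lambda>x. ?S k x - w x)) \<longlonglongrightarrow> 0"
    by (rule L2_complete[OF S])
  then show ?thesis by (auto simp: L2_sums_iff)
qed

section \<open>The Hilbert structure on the fractional space\<close>

abbreviation \<H> :: "('a \<Rightarrow> real) set" where "\<H> \<equiv> Hr \<Omega> \<Lambda> \<phi> s"

text \<open>The form is taken literally from the weak formulation; its spectral series is derived
  afterwards.\<close>

definition energy :: "('a \<Rightarrow> real) \<Rightarrow> ('a \<Rightarrow> real) \<Rightarrow> real" where
  "energy u v = ip (frac_laplacian \<Omega> \<Lambda> \<phi> (s/2) u) (frac_laplacian \<Omega> \<Lambda> \<phi> (s/2) v)"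

lemma H_L2: "u \<in> \<H> \<Longrightarrow> u \<in> L2 \<Omega>"
  by (simp add: Hr_def)

lemma powr_half_square: "(\<Lambda> n powr (s/2))\<^sup>2 = \<Lambda> n powr s"
  by (simp add: power2_eq_square powr_add[symmetric])

lemma L2_sums_frac_laplacian:
  assumes "u \<in> \<H>"
  shows "L2_sums \<Omega> (\<lambda>n x. \<Lambda> n powr (s/2) * coeff u n * \<phi> n x) (frac_laplacian \<Omega> \<Lambda> \<phi> (s/2) u)"
proof -
  have "\<exists>w. L2_sums \<Omega> (\<lambda>n x. \<Lambda> n powr (s/2) * coeff u n * \<phi> n x) w"
    by (rule L2_sums_exists) (use assms in \<open>simp add: Hr_def power_mult_distrib powr_half_square\<close>)
  then show ?thesis unfolding frac_laplacian_def by (rule someI_ex)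
qed

lemma frac_laplacian_L2: "u \<in> \<H> \<Longrightarrow> frac_laplacian \<Omega> \<Lambda> \<phi> (s/2) u \<in> L2 \<Omega>"
  using L2_sums_frac_laplacian by (simp add: L2_sums_iff)

text \<open>Parseval for the two fractional powers. The series does not depend on the chosen
  representatives, so the algebra of \<open>energy\<close> is derived from it.\<close>

lemma energy_sums:
  assumes "u \<in> \<H>" "v \<in> \<H>"
  shows "(\<lambda>n. \<Lambda> n powr s * (coeff u n * coeff v n)) sums energy u v"
proof -
  have "(\<lambda>n. (\<Lambda> n powr (s/2) * coeff u n) * (\<Lambda> n powr (s/2) * coeff v n)) sums energy u v"
    using Parseval[OF frac_laplacian_L2[OF assms(1)] frac_laplacian_L2[OF assms(2)]] assms
    by (simp add: energy_def L2_sums_coeff[OF L2_sums_frac_laplacian])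
  moreover have "(\<Lambda> n powr (s/2) * a) * (\<Lambda> n powr (s/2) * b) = \<Lambda> n powr s * (a * b)" for n a b
    using powr_half_square[of n] by (simp add: power2_eq_square algebra_simps)
  ultimately show ?thesis by simp
qed

lemma Hr_norm_eq: "u \<in> \<H> \<Longrightarrow> Hr_norm \<Omega> \<Lambda> \<phi> s u = sqrt (energy u u)"
  using energy_sums[of u u] by (simp add: Hr_norm_def sums_iff power2_eq_square)

lemma coeff_add: "u \<in> L2 \<Omega> \<Longrightarrow> v \<in> L2 \<Omega> \<Longrightarrow> coeff (\<lambda>x. u x + v x) n = coeff u n + coeff v n"
  by (simp add: coeff_eq ip_add eigenfunction_L2)

lemma coeff_diff: "u \<in> L2 \<Omega> \<Longrightarrow> v \<in> L2 \<Omega> \<Longrightarrow> coeff (\<lambda>x. u x - v x) n = coeff u n - coeff v n"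
  by (simp add: coeff_eq ip_diff eigenfunction_L2)

lemma coeff_cmult: "coeff (\<lambda>x. c * u x) n = c * coeff u n"
  by (simp add: coeff_eq ip_cmult)

lemma H_cmult: "u \<in> \<H> \<Longrightarrow> (\<lambda>x. c * u x) \<in> \<H>"
  using summable_mult[of "\<lambda>n. \<Lambda> n powr s * (coeff u n)\<^sup>2" "c\<^sup>2"]
  by (auto simp: Hr_def coeff_cmult power_mult_distrib algebra_simps)

lemma H_add:
  assumes "u \<in> \<H>" "v \<in> \<H>"
  shows "(\<lambda>x. u x + v x) \<in> \<H>"
proof -
  have "(\<lambda>n. \<Lambda> n powr s * (coeff u n * coeff u n) + (2 * (\<Lambda> n powr s * (coeff u n * coeff v n))
          + \<Lambda> n powr s * (coeff v n * coeff v n)))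
        sums (energy u u + (2 * energy u v + energy v v))"
    by (intro sums_add sums_mult energy_sums assms)
  then have "summable (\<lambda>n. \<Lambda> n powr s * (coeff u n + coeff v n)\<^sup>2)"
    by (auto simp: sums_iff power2_eq_square algebra_simps)
  then show ?thesis using assms by (auto simp: Hr_def coeff_add)
qed

lemma H_diff: "u \<in> \<H> \<Longrightarrow> v \<in> \<H> \<Longrightarrow> (\<lambda>x. u x - v x) \<in> \<H>"
  using H_add[of u "\<lambda>x. (-1) * v x"] H_cmult[of v "-1"] by simp

lemma energy_nonneg: "energy u u \<ge> 0"
  by (simp add: energy_def ip_self_nonneg)

lemma energy_commute: "energy u v = energy v u"
  by (simp add: energy_def ip_commute)

text \<open>The representative chosen for a sum need not be the pointwise sum of representatives;
  additivity therefore passes through coefficients.\<close>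

lemma energy_add:
  assumes "u \<in> \<H>" "v \<in> \<H>" "w \<in> \<H>"
  shows "energy (\<lambda>x. u x + v x) w = energy u w + energy v w"
  using sums_add[OF energy_sums[OF assms(1,3)] energy_sums[OF assms(2,3)]]
    energy_sums[OF H_add[OF assms(1,2)] assms(3)] assms
  by (auto simp: coeff_add H_L2 algebra_simps sums_iff)

lemma energy_cmult:
  assumes "u \<in> \<H>" "w \<in> \<H>"
  shows "energy (\<lambda>x. c * u x) w = c * energy u w"
  using sums_mult[OF energy_sums[OF assms], of c] energy_sums[OF H_cmult[OF assms(1)] assms(2), of c]
  by (auto simp: coeff_cmult algebra_simps sums_iff)

lemma energy_diff:
  assumes "u \<in> \<H>" "v \<in> \<H>" "w \<in> \<H>"
  shows "energy (\<lambda>x. u x - v x) w = energy u w - energy v w"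
  using energy_add[OF assms(1) H_cmult[OF assms(2), of "-1"] assms(3)] energy_cmult[OF assms(2,3), of "-1"]
  by simp

lemma energy_add_self:
  assumes "u \<in> \<H>" "v \<in> \<H>"
  shows "energy (\<lambda>x. u x + v x) (\<lambda>x. u x + v x) = energy u u + 2 * energy u v + energy v v"
  using energy_add[OF assms H_add[OF assms]] energy_add[OF assms(1,2,1)] energy_add[OF assms(1,2,2)]
  by (simp add: energy_commute[of u "\<lambda>x. u x + v x"] energy_commute[of v "\<lambda>x. u x + v x"]
      energy_commute[of v u])

lemma energy_cmult_self: "u \<in> \<H> \<Longrightarrow> energy (\<lambda>x. c * u x) (\<lambda>x. c * u x) = c\<^sup>2 * energy u u"
  using energy_cmult[of u "\<lambda>x. c * u x" c] energy_cmult[of u u c] H_cmult[of u c]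
  by (simp add: energy_commute[of u "\<lambda>x. c * u x"] power2_eq_square)

lemma energy_diff_self:
  assumes "u \<in> \<H>" "v \<in> \<H>"
  shows "energy (\<lambda>x. u x - v x) (\<lambda>x. u x - v x) = energy u u - 2 * energy u v + energy v v"
  using energy_add_self[OF assms(1) H_cmult[OF assms(2), of "-1"]] energy_cmult_self[OF assms(2), of "-1"]
    energy_cmult[OF assms(2,1), of "-1"]
  by (simp add: energy_commute[of u v] energy_commute[of u "\<lambda>x. - v x"])

lemma energy_Cauchy_Schwarz:
  "u \<in> \<H> \<Longrightarrow> v \<in> \<H> \<Longrightarrow> \<bar>energy u v\<bar> \<le> sqrt (energy u u) * sqrt (energy v v)"
  unfolding energy_def by (intro ip_Cauchy_Schwarz frac_laplacian_L2)

lemma energy_triangle: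
  assumes "u \<in> \<H>" "v \<in> \<H>"
  shows "sqrt (energy (\<lambda>x. u x + v x) (\<lambda>x. u x + v x)) \<le> sqrt (energy u u) + sqrt (energy v v)"
proof (rule real_le_lsqrt)
  show "energy (\<lambda>x. u x + v x) (\<lambda>x. u x + v x) \<le> (sqrt (energy u u) + sqrt (energy v v))\<^sup>2"
    using energy_Cauchy_Schwarz[OF assms] energy_nonneg[of u] energy_nonneg[of v]
    by (simp add: energy_add_self[OF assms] power2_sum)
qed (simp add: energy_nonneg)

text \<open>A Poincare inequality: each coefficient is weighted at least by the power of the
  smallest eigenvalue.\<close>

lemma ip_le_energy:
  assumes "u \<in> \<H>"
  shows "ip u u \<le> \<Lambda> 0 powr (- s) * energy u u"
proof (rule sums_le[OF _ Parseval[OF H_L2[OF assms] H_L2[OF assms]] sums_mult[OF energy_sums[OF assms assms]]])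
  fix n
  have "1 \<le> \<Lambda> 0 powr (- s) * \<Lambda> n powr s"
    using eigenvalue_bounds(1) eigenvalue_bounds(2)[of n] s_pos powr_mono2[of s "\<Lambda> 0" "\<Lambda> n"]
    by (simp add: powr_minus_divide order_less_imp_not_eq2)
  from mult_right_mono[OF this, of "coeff u n * coeff u n"]
  show "coeff u n * coeff u n \<le> \<Lambda> 0 powr (- s) * (\<Lambda> n powr s * (coeff u n * coeff u n))"
    by (simp add: mult.assoc)
qed

lemma energy_eq_0_imp_AE: 
  assumes "u \<in> \<H>" "energy u u \<le> 0"
  shows "AE x in M. u x = 0"
proof (rule ip_self_eq_0_imp_AE[OF H_L2[OF assms(1)]])
  show "ip u u = 0"
    using ip_le_energy[OF assms(1)] assms(2) energy_nonneg[of u] ip_self_nonneg[of u] by auto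
qed

text \<open>The Poincare inequality provides an \<open>L2\<close> limit and an a.e. convergent
  subsequence. Coefficients converge one by one, which identifies the limit in the stronger norm
  too.\<close>

lemma energy_complete:
  fixes U :: "nat \<Rightarrow> 'a \<Rightarrow> real"
  assumes U: "\<And>n. U n \<in> \<H>"
    and Cauchy: "\<And>e. e > 0 \<Longrightarrow> \<exists>N. \<forall>m\<ge>N. \<forall>n\<ge>N. energy (\<lambda>x. U m x - U n x) (\<lambda>x. U m x - U n x) \<le> e"
  obtains u r where "u \<in> \<H>" "strict_mono r" "AE x in M. (\<lambda>k. U (r k) x) \<longlonglongrightarrow> u x"
    "(\<lambda>n. energy (\<lambda>x. U n x - u x) (\<lambda>x. U n x - u x)) \<longlonglongrightarrow> 0"
proof -
  define l where "l = \<Lambda> 0 powr (- s)"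
  have l: "l > 0" using eigenvalue_bounds(1) by (simp add: l_def)
  have UL: "U n \<in> L2 \<Omega>" for n using U by (rule H_L2)
  have "\<exists>N. \<forall>m\<ge>N. \<forall>n\<ge>N. ip (\<lambda>x. U m x - U n x) (\<lambda>x. U m x - U n x) \<le> e" if "e > 0" for e
  proof -
    from Cauchy[of "e / l"] that l obtain N where
      N: "\<And>m n. m \<ge> N \<Longrightarrow> n \<ge> N \<Longrightarrow> energy (\<lambda>x. U m x - U n x) (\<lambda>x. U m x - U n x) \<le> e / l"
      by auto
    have "ip (\<lambda>x. U m x - U n x) (\<lambda>x. U m x - U n x) \<le> e" if "m \<ge> N" "n \<ge> N" for m n
      using ip_le_energy[OF H_diff[OF U U], of m n] N[OF that] l
      by (simp add: l_def[symmetric] field_simps)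
    then show ?thesis by blast
  qed
  then obtain u r where u: "u \<in> L2 \<Omega>" and r: "strict_mono r"
    and AE: "AE x in M. (\<lambda>k. U (r k) x) \<longlonglongrightarrow> u x"
    and L2: "(\<lambda>n. ip (\<lambda>x. U n x - u x) (\<lambda>x. U n x - u x)) \<longlonglongrightarrow> 0"
    by (rule L2_complete[OF UL])
  have coeff_lim: "(\<lambda>k. coeff (U k) n) \<longlonglongrightarrow> coeff u n" for n
    using ip_tendsto[OF UL u eigenfunction_L2 L2] by (simp add: coeff_eq)
  have close: "\<exists>N. \<forall>n\<ge>N. (\<lambda>x. U n x - u x) \<in> \<H> \<and> energy (\<lambda>x. U n x - u x) (\<lambda>x. U n x - u x) \<le> e"
    if "e > 0" for e
  proof -
    from Cauchy[OF that] obtain N where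
      N: "\<And>m n. m \<ge> N \<Longrightarrow> n \<ge> N \<Longrightarrow> energy (\<lambda>x. U m x - U n x) (\<lambda>x. U m x - U n x) \<le> e" by blast
    have "(\<lambda>x. U m x - u x) \<in> \<H> \<and> energy (\<lambda>x. U m x - u x) (\<lambda>x. U m x - u x) \<le> e" if m: "m \<ge> N" for m
    proof -
      have d: "(\<lambda>x. U m x - u x) \<in> L2 \<Omega>" by (rule L2_diff[OF UL u])
      \<comment> \<open>A finite sum permits the passage \<open>n\<close> to infinity inside the
        Cauchy bound. The resulting bound, uniform in \<open>k\<close>, gives both membership in
        \<open>\<H>\<close> and the distance estimate.\<close>
      have partial: "(\<Sum>i<k. \<Lambda> i powr s * (coeff (\<lambda>x. U m x - u x) i)\<^sup>2) \<le> e" for k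
      proof (rule LIMSEQ_le_const2)
        show "(\<lambda>n. \<Sum>i<k. \<Lambda> i powr s * (coeff (U m) i - coeff (U n) i)\<^sup>2)
                \<longlonglongrightarrow> (\<Sum>i<k. \<Lambda> i powr s * (coeff (\<lambda>x. U m x - u x) i)\<^sup>2)"
          unfolding coeff_diff[OF UL u] by (intro tendsto_intros coeff_lim)
        have "(\<Sum>i<k. \<Lambda> i powr s * (coeff (U m) i - coeff (U n) i)\<^sup>2) \<le> e" if "n \<ge> N" for n
        proof -
          have sums: "(\<lambda>i. \<Lambda> i powr s * (coeff (U m) i - coeff (U n) i)\<^sup>2)
                        sums energy (\<lambda>x. U m x - U n x) (\<lambda>x. U m x - U n x)"
            using energy_sums[OF H_diff[OF U U] H_diff[OF U U], of m n m n]
            by (simp add: coeff_diff[OF UL UL] power2_eq_square)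
          then show ?thesis
            using sum_le_suminf[of _ "{..<k}"] N[OF m that] by (force simp: sums_iff)
        qed
        then show "\<exists>N. \<forall>n\<ge>N. (\<Sum>i<k. \<Lambda> i powr s * (coeff (U m) i - coeff (U n) i)\<^sup>2) \<le> e" by blast
      qed
      have summable: "summable (\<lambda>i. \<Lambda> i powr s * (coeff (\<lambda>x. U m x - u x) i)\<^sup>2)"
        by (rule summableI_nonneg_bounded[OF _ partial]) simp
      then have H: "(\<lambda>x. U m x - u x) \<in> \<H>" using d by (simp add: Hr_def)
      have "energy (\<lambda>x. U m x - u x) (\<lambda>x. U m x - u x) = (\<Sum>i. \<Lambda> i powr s * (coeff (\<lambda>x. U m x - u x) i)\<^sup>2)"
        using energy_sums[OF H H] by (simp add: sums_iff power2_eq_square)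
      also have "\<dots> \<le> e" by (rule suminf_le_const[OF summable partial])
      finally show ?thesis using H by blast
    qed
    then show ?thesis by blast
  qed
  from close[of 1] obtain N where "(\<lambda>x. U N x - u x) \<in> \<H>" by auto
  from H_diff[OF U[of N] this] have u: "u \<in> \<H>" by simp
  have "(\<lambda>n. energy (\<lambda>x. U n x - u x) (\<lambda>x. U n x - u x)) \<longlonglongrightarrow> 0"
  proof (rule LIMSEQ_I)
    fix e :: real assume "e > 0"
    then obtain N where "\<And>n. n \<ge> N \<Longrightarrow> energy (\<lambda>x. U n x - u x) (\<lambda>x. U n x - u x) \<le> e / 2"
      using close[of "e / 2"] by auto
    with \<open>e > 0\<close> have "norm (energy (\<lambda>x. U n x - u x) (\<lambda>x. U n x - u x) - 0) < e" if "n \<ge> N" for n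
      using that energy_nonneg[of "\<lambda>x. U n x - u x"] by force
    then show "\<exists>N. \<forall>n\<ge>N. norm (energy (\<lambda>x. U n x - u x) (\<lambda>x. U n x - u x) - 0) < e" by blast
  qed
  with u r AE show thesis by (rule that)
qed

end

section \<open>The modular\<close>

text \<open>Rounding \<open>u\<close> down to multiples of \<open>1 / Suc n\<close> leaves countably
  many values, on each of which measurability in \<open>x\<close> for fixed \<open>t\<close> is
  enough; continuity in \<open>t\<close> handles the limit.\<close>

lemma Caratheodory_measurable:
  fixes h :: "'a \<Rightarrow> real \<Rightarrow> real"
  assumes cont: "\<And>x. x \<in> space M \<Longrightarrow> continuous_on UNIV (h x)"
    and meas: "\<And>t. (\<lambda>x. h x t) \<in> borel_measurable M"
    and u [measurable]: "u \<in> borel_measurable M"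
  shows "(\<lambda>x. h x (u x)) \<in> borel_measurable M"
proof (rule borel_measurable_LIMSEQ_real)
  define v where "v n x = real_of_int \<lfloor>real (Suc n) * u x\<rfloor> / real (Suc n)" for n x
  show "(\<lambda>n. h x (v n x)) \<longlonglongrightarrow> h x (u x)" if x: "x \<in> space M" for x
  proof (rule continuous_on_tendsto_compose[OF cont[OF x]])
    have "\<bar>v n x - u x\<bar> \<le> 1 / real (Suc n)" for n
    proof -
      have "v n x - u x = (real_of_int \<lfloor>real (Suc n) * u x\<rfloor> - real (Suc n) * u x) / real (Suc n)"
        by (simp add: v_def diff_divide_distrib)
      also have "\<bar>\<dots>\<bar> \<le> 1 / real (Suc n)"
        unfolding abs_divide by (rule frac_le) (auto, linarith)
      finally show ?thesis .
    qed
    then have "(\<lambda>n. v n x - u x) \<longlonglongrightarrow> 0"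
      by (intro Lim_null_comparison[OF _ LIMSEQ_Suc[OF lim_1_over_n]]) simp
    then show "(\<lambda>n. v n x) \<longlonglongrightarrow> u x" by (rule LIM_zero_cancel)
  qed auto
  show "(\<lambda>x. h x (v n x)) \<in> borel_measurable M" for n
  proof -
    have "(\<lambda>x. h x (real_of_int (\<lfloor>real (Suc n) * u x\<rfloor>) / real (Suc n))) \<in> borel_measurable M"
      by (rule measurable_compose_countable'[where I = UNIV and g = "\<lambda>x. \<lfloor>real (Suc n) * u x\<rfloor>"
            and f = "\<lambda>i x. h x (real_of_int i / real (Suc n))"]) (auto intro: meas)
    then show ?thesis by (simp add: v_def)
  qed
qed

text \<open>The preceding lemma on the product space, with the second coordinate as the inserted
  function, gives joint measurability; the primitive is then a parameter integral with a measurable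
  cut-off.\<close>

lemma Caratheodory_primitive_measurable:
  fixes h :: "'a \<Rightarrow> real \<Rightarrow> real"
  assumes cont: "\<And>x. x \<in> space M \<Longrightarrow> continuous_on UNIV (h x)"
    and meas: "\<And>t. (\<lambda>x. h x t) \<in> borel_measurable M"
    and u [measurable]: "u \<in> borel_measurable M"
  shows "(\<lambda>x. integral {0..\<bar>u x\<bar>} (h x)) \<in> borel_measurable M"
proof -
  have joint: "(\<lambda>z. h (fst z) (snd z)) \<in> borel_measurable (M \<Otimes>\<^sub>M lborel)"
    by (rule Caratheodory_measurable)
       (auto simp: space_pair_measure intro: cont measurable_compose[OF measurable_fst meas])
  have "(\<lambda>z. of_bool (0 \<le> snd z \<and> snd z \<le> \<bar>u (fst z)\<bar>) * h (fst z) (snd z))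
          \<in> borel_measurable (M \<Otimes>\<^sub>M lborel)"
    using joint by measurable
  then have "case_prod (\<lambda>x t. of_bool (0 \<le> t \<and> t \<le> \<bar>u x\<bar>) * h x t) \<in> borel_measurable (M \<Otimes>\<^sub>M lborel)"
    by (simp add: case_prod_beta')
  then have "(\<lambda>x. LINT t|lborel. of_bool (0 \<le> t \<and> t \<le> \<bar>u x\<bar>) * h x t) \<in> borel_measurable M"
    by (rule lborel.borel_measurable_lebesgue_integral)
  moreover have "(LINT t|lborel. of_bool (0 \<le> t \<and> t \<le> \<bar>u x\<bar>) * h x t) = integral {0..\<bar>u x\<bar>} (h x)"
    if "x \<in> space M" for x
  proof -
    have "set_integrable lborel {0..\<bar>u x\<bar>} (h x)"
      by (rule borel_integrable_atLeastAtMost')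
         (use cont[OF that] continuous_on_subset in blast)
    from set_borel_integral_eq_integral(2)[OF this] show ?thesis
      by (simp add: set_lebesgue_integral_def indicator_def)
  qed
  ultimately show ?thesis by (simp cong: measurable_cong)
qed

text \<open>Rests on completeness of Lebesgue measure. The fibre conditions hold only off a null
  set, so \<open>f\<close> has to be modified there and the change undone.\<close>

lemma lebesgue_on_measurable_AE:
  fixes g h :: "'a::euclidean_space \<Rightarrow> real"
  assumes S: "S \<in> sets lebesgue" and g: "g \<in> borel_measurable (lebesgue_on S)"
    and AE: "AE x in lebesgue_on S. g x = h x"
  shows "h \<in> borel_measurable (lebesgue_on S)"
proof -
  have "(\<lambda>x. if x \<in> S then g x else 0) \<in> borel_measurable lebesgue"
    using g S by (simp add: borel_measurable_if)
  moreover have "AE x in lebesgue. (if x \<in> S then g x else 0) = (if x \<in> S then h x else 0)"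
    using AE S by (auto simp: AE_restrict_space_iff)
  ultimately have "(\<lambda>x. if x \<in> S then h x else 0) \<in> borel_measurable lebesgue"
    by (rule borel_measurable_AE)
  then show ?thesis using S by (simp add: borel_measurable_if)
qed

locale semilinear_problem = dirichlet_spectrum +
  fixes f :: "'a \<Rightarrow> real \<Rightarrow> real" and c1 c2 :: real
  assumes structural: "structural_condition \<Omega> f"
    and c1: "0 < c1" "c1 \<le> 1" and c2: "0 < c2" "c2 \<le> 1"
    and Delta2: "AE x in lebesgue_on \<Omega>. \<forall>t\<ge>0.
        c1 * (t * f x t) \<le> even_primitive f x t \<and> even_primitive f x t \<le> t * f x t \<and>
        c2 * (t * fibre_inverse f x t) \<le> even_primitive (fibre_inverse f) x t \<and>
        even_primitive (fibre_inverse f) x t \<le> t * fibre_inverse f x t"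
begin

abbreviation F :: "'a \<Rightarrow> real \<Rightarrow> real" where "F \<equiv> even_primitive f"

lemma domain_lebesgue: "\<Omega> \<in> sets lebesgue"
  using open_domain by simp

text \<open>The bridge from the a.e. hypotheses to the fibre locale; the equation lets the facts
  about \<open>H\<close> be read as facts about \<open>F x\<close>.\<close>

lemma AE_Delta2_function: "AE x in M. Delta2_function (f x) c1 c2 \<and> odd_increasing.H (f x) = F x"
proof -
  have "AE x in M. (\<forall>t. f x (- t) = - f x t) \<and> strict_mono (f x) \<and>
        continuous_on UNIV (f x) \<and> f x 0 = 0 \<and> filterlim (f x) at_top at_top"
    using structural by (simp add: structural_condition_def)
  with Delta2 show ?thesis
  proof eventually_elim
    case (elim x)
    then interpret odd_increasing "f x" by unfold_locales auto
    have H: "H = F x" by (simp add: fun_eq_iff H_def even_primitive_def)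
    have "Delta2_function (f x) c1 c2"
      using elim c1 c2 by unfold_locales (auto simp: H fibre_inverse_def even_primitive_def)
    with H show ?case by simp
  qed
qed

lemma AE_F_nonneg: "AE x in M. \<forall>t. 0 \<le> F x t"
  and AE_F_zero: "AE x in M. F x 0 = 0"
  and AE_F_mono: "AE x in M. \<forall>a b. \<bar>a\<bar> \<le> \<bar>b\<bar> \<longrightarrow> F x a \<le> F x b"
  and AE_F_tangent: "AE x in M. \<forall>a b. F x b - F x a \<le> f x b * (b - a)"
  and AE_F_midpoint: "AE x in M. \<forall>a b. F x ((a + b) / 2) \<le> (F x a + F x b) / 2"
  and AE_isCont_F: "AE x in M. \<forall>t. isCont (F x) t"
  and AE_isCont_f: "AE x in M. \<forall>t. isCont (f x) t"
  and AE_f_mono: "AE x in M. mono (f x) \<and> f x 0 = 0"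
  and AE_f_times_le: "AE x in M. \<forall>a b. \<bar>f x a * b\<bar> \<le> (F x a + F x b) / c1"
proof -
  have all: "AE x in M. (\<forall>t. 0 \<le> F x t) \<and> F x 0 = 0 \<and> (\<forall>a b. \<bar>a\<bar> \<le> \<bar>b\<bar> \<longrightarrow> F x a \<le> F x b) \<and>
      (\<forall>a b. F x b - F x a \<le> f x b * (b - a)) \<and> (\<forall>a b. F x ((a + b) / 2) \<le> (F x a + F x b) / 2) \<and>
      (\<forall>t. isCont (F x) t) \<and> (\<forall>t. isCont (f x) t) \<and> mono (f x) \<and> f x 0 = 0 \<and>
      (\<forall>a b. \<bar>f x a * b\<bar> \<le> (F x a + F x b) / c1)"
    using AE_Delta2_function
  proof eventually_elim
    case (elim x)
    then interpret Delta2_function "f x" c1 c2 by simp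
    have H: "H = F x" using elim by simp
    show ?case
      unfolding H[symmetric]
      using H_nonneg H_zero H_mono H_tangent H_midpoint isCont_H isCont_h mono zero h_times_le
      by (auto simp: monoI)
  qed
  show "AE x in M. \<forall>t. 0 \<le> F x t" using all by eventually_elim simp
  show "AE x in M. F x 0 = 0" using all by eventually_elim simp
  show "AE x in M. \<forall>a b. \<bar>a\<bar> \<le> \<bar>b\<bar> \<longrightarrow> F x a \<le> F x b" using all by eventually_elim simp
  show "AE x in M. \<forall>a b. F x b - F x a \<le> f x b * (b - a)" using all by eventually_elim (elim conjE)
  show "AE x in M. \<forall>a b. F x ((a + b) / 2) \<le> (F x a + F x b) / 2" using all by eventually_elim (elim conjE)
  show "AE x in M. \<forall>t. isCont (F x) t" using all by eventually_elim simp
  show "AE x in M. \<forall>t. isCont (f x) t" using all by eventually_elim simp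
  show "AE x in M. mono (f x) \<and> f x 0 = 0" using all by eventually_elim simp
  show "AE x in M. \<forall>a b. \<bar>f x a * b\<bar> \<le> (F x a + F x b) / c1" using all by eventually_elim (elim conjE)
qed

lemma F_growth:
  obtains K where "K \<ge> 1" "AE x in M. \<forall>t. F x (L * t) \<le> K * F x t"
proof -
  obtain K where K: "K \<ge> 1"
    "\<And>h c2 t. Delta2_function h c1 c2 \<Longrightarrow> odd_increasing.H h (L * t) \<le> K * odd_increasing.H h t"
    using Delta2_function_growth[OF c1, of L] by blast
  have "AE x in M. \<forall>t. F x (L * t) \<le> K * F x t"
    using AE_Delta2_function by eventually_elim (metis K(2))
  with K(1) show thesis by (rule that)
qed

lemma F_superlinear:
  obtains \<mu>0 where "\<mu>0 > 0" "AE x in M. \<forall>t. \<forall>\<mu>\<ge>\<mu>0. L * \<mu> * F x (t / \<mu>) \<le> F x t"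
proof -
  obtain \<mu>0 where \<mu>0: "\<mu>0 > 0"
    "\<And>h t \<mu>. Delta2_function h c1 c2 \<Longrightarrow> \<mu> \<ge> \<mu>0
           \<Longrightarrow> L * \<mu> * odd_increasing.H h (t / \<mu>) \<le> odd_increasing.H h t"
    using Delta2_function_superlinear[OF c1 c2, of L] by blast
  have "AE x in M. \<forall>t. \<forall>\<mu>\<ge>\<mu>0. L * \<mu> * F x (t / \<mu>) \<le> F x t"
    using AE_Delta2_function by eventually_elim (metis \<mu>0(2))
  with \<mu>0(1) show thesis by (rule that)
qed

text \<open>Writing \<open>a + b\<close> as twice the midpoint combines the growth bound for the
  factor 2 with midpoint convexity.\<close>

lemma F_add:
  obtains K where "K \<ge> 1" "AE x in M. \<forall>a b. F x (a + b) \<le> K * (F x a + F x b)"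
proof -
  obtain K where K: "K \<ge> 1" "AE x in M. \<forall>t. F x (2 * t) \<le> K * F x t"
    using F_growth[of 2] by blast
  have "AE x in M. \<forall>a b. F x (a + b) \<le> K * (F x a + F x b)"
    using K(2) AE_F_midpoint AE_F_nonneg
  proof eventually_elim
    case (elim x)
    show ?case
    proof (intro allI)
      fix a b :: real
      have "2 * ((a + b) / 2) = a + b" by simp
      then have "F x (a + b) \<le> K * F x ((a + b) / 2)" using elim(1) by metis
      also have "\<dots> \<le> K * ((F x a + F x b) / 2)" using elim(2) K(1) by (intro mult_left_mono) auto
      also have "\<dots> \<le> K * (F x a + F x b)" using elim(3) K(1) by (intro mult_left_mono) auto
      finally show "F x (a + b) \<le> K * (F x a + F x b)" .
    qed
  qed
  with K(1) show thesis by (rule that)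
qed

lemma f_measurable: "u \<in> borel_measurable M \<Longrightarrow> (\<lambda>x. f x (u x)) \<in> borel_measurable M"
  and F_measurable: "u \<in> borel_measurable M \<Longrightarrow> (\<lambda>x. F x (u x)) \<in> borel_measurable M"
proof -
  assume u: "u \<in> borel_measurable M"
  have "AE x in M. continuous_on UNIV (f x)" using structural by (auto simp: structural_condition_def)
  then obtain N where N: "N \<in> null_sets M" "{x \<in> space M. \<not> continuous_on UNIV (f x)} \<subseteq> N"
    unfolding eventually_ae_filter by blast
  \<comment> \<open>Setting the function to zero on the null set makes every fibre continuous, as
    the measurability lemmas demand.\<close>
  define h where "h x = (if x \<in> N then (\<lambda>t. 0) else f x)" for x
  have cont: "continuous_on UNIV (h x)" if "x \<in> space M" for x
    using N(2) that by (auto simp: h_def)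
  have meas: "(\<lambda>x. h x t) \<in> borel_measurable M" for t
  proof -
    have "(\<lambda>x. if x \<in> N then 0 else f x t) \<in> borel_measurable M"
      using N(1) structural by (intro measurable_If_set) (auto simp: structural_condition_def)
    then show ?thesis by (simp add: h_def if_distribR)
  qed
  have AE: "AE x in M. h x = f x"
    using AE_not_in[OF N(1)] by eventually_elim (simp add: h_def)
  show "(\<lambda>x. f x (u x)) \<in> borel_measurable M"
    by (rule lebesgue_on_measurable_AE[OF domain_lebesgue Caratheodory_measurable[OF cont meas u]])
       (use AE in \<open>auto elim: eventually_mono\<close>)
  show "(\<lambda>x. F x (u x)) \<in> borel_measurable M"
    by (rule lebesgue_on_measurable_AE[OF domain_lebesgue Caratheodory_primitive_measurable[OF cont meas u]])
       (use AE in \<open>auto elim: eventually_mono simp: even_primitive_def\<close>)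
qed

section \<open>The modular, its space and the Luxemburg norm\<close>

definition \<rho> :: "('a \<Rightarrow> real) \<Rightarrow> real" where "\<rho> u = (LINT x|M. F x (u x))"

abbreviation L\<^sub>F :: "('a \<Rightarrow> real) set" where "L\<^sub>F \<equiv> LF \<Omega> f"

lemma LF_measurable: "u \<in> L\<^sub>F \<Longrightarrow> u \<in> borel_measurable M"
  and LF_integrable: "u \<in> L\<^sub>F \<Longrightarrow> integrable M (\<lambda>x. F x (u x))"
  by (simp_all add: LF_def)

lemma modular_nonneg: "\<rho> u \<ge> 0"
  unfolding \<rho>_def using AE_F_nonneg by (intro integral_nonneg_AE) auto

lemma LF_I:
  assumes u: "u \<in> borel_measurable M" and g: "integrable M g"
    and le: "AE x in M. F x (u x) \<le> g x"
  shows "u \<in> L\<^sub>F"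
proof -
  have "integrable M (\<lambda>x. F x (u x))"
    by (rule Bochner_Integration.integrable_bound[OF g F_measurable[OF u]])
       (use le AE_F_nonneg in \<open>eventually_elim, force\<close>)
  with u show ?thesis by (simp add: LF_def)
qed

lemma LF_add:
  assumes u: "u \<in> L\<^sub>F" and v: "v \<in> L\<^sub>F"
  shows "(\<lambda>x. u x + v x) \<in> L\<^sub>F"
proof -
  obtain K where K: "AE x in M. \<forall>a b. F x (a + b) \<le> K * (F x a + F x b)" using F_add by blast
  show ?thesis
    by (rule LF_I[where g = "\<lambda>x. K * (F x (u x) + F x (v x))"])
       (use K LF_measurable[OF u] LF_measurable[OF v] LF_integrable[OF u] LF_integrable[OF v] in
         \<open>auto elim: eventually_mono\<close>)
qed

lemma LF_cmult:
  assumes u: "u \<in> L\<^sub>F"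
  shows "(\<lambda>x. c * u x) \<in> L\<^sub>F"
proof -
  obtain K where K: "AE x in M. \<forall>t. F x (c * t) \<le> K * F x t" using F_growth by blast
  show ?thesis
    by (rule LF_I[where g = "\<lambda>x. K * F x (u x)"])
       (use K LF_measurable[OF u] LF_integrable[OF u] in \<open>auto elim: eventually_mono\<close>)
qed

lemma f_times_integrable:
  assumes u: "u \<in> L\<^sub>F" and v: "v \<in> L\<^sub>F"
  shows "integrable M (\<lambda>x. f x (u x) * v x)"
proof (rule Bochner_Integration.integrable_bound)
  show "integrable M (\<lambda>x. (F x (u x) + F x (v x)) / c1)"
    using LF_integrable[OF u] LF_integrable[OF v] by simp
  show "(\<lambda>x. f x (u x) * v x) \<in> borel_measurable M"
    using f_measurable[OF LF_measurable[OF u]] LF_measurable[OF v] by simp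
  show "AE x in M. norm (f x (u x) * v x) \<le> norm ((F x (u x) + F x (v x)) / c1)"
    using AE_f_times_le by eventually_elim (metis abs_ge_self order_trans real_norm_def)
qed

text \<open>The right-hand side is itself an admissible scaling in the infimum: superlinearity
  divides the modular by at least \<open>L\<close> times that scaling, which is no smaller than
  \<open>\<rho> u\<close>. A large \<open>L\<close> makes the modular term cheap.\<close>

lemma luxemburg_norm_le:
  assumes L: "L > 0"
  obtains \<mu>0 where "\<mu>0 > 0" "\<And>u. u \<in> L\<^sub>F \<Longrightarrow> luxemburg_norm \<Omega> f u \<le> \<mu>0 + \<rho> u / L"
proof -
  obtain \<mu>0 where \<mu>0: "\<mu>0 > 0" "AE x in M. \<forall>t. \<forall>\<mu>\<ge>\<mu>0. L * \<mu> * F x (t / \<mu>) \<le> F x t"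
    using F_superlinear by blast
  have "luxemburg_norm \<Omega> f u \<le> \<mu>0 + \<rho> u / L" if u: "u \<in> L\<^sub>F" for u
  proof -
    define \<mu> where "\<mu> = \<mu>0 + \<rho> u / L"
    have \<mu>: "\<mu> \<ge> \<mu>0" "\<mu> > 0" "\<rho> u \<le> L * \<mu>"
      using modular_nonneg[of u] \<mu>0(1) L by (auto simp: \<mu>_def field_simps intro!: add_pos_nonneg)
    have int: "integrable M (\<lambda>x. F x (u x) / (L * \<mu>))" using LF_integrable[OF u] by simp
    have "(\<integral>\<^sup>+ x. ennreal (F x (u x / \<mu>)) \<partial>M) \<le> (\<integral>\<^sup>+ x. ennreal (F x (u x) / (L * \<mu>)) \<partial>M)"
    proof (rule nn_integral_mono_AE)
      show "AE x in M. ennreal (F x (u x / \<mu>)) \<le> ennreal (F x (u x) / (L * \<mu>))"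
        using \<mu>0(2)
      proof eventually_elim
        case (elim x)
        then have "L * \<mu> * F x (u x / \<mu>) \<le> F x (u x)" using \<mu>(1) by blast
        then show ?case using L \<mu> by (intro ennreal_leI) (simp add: field_simps)
      qed
    qed
    also have "\<dots> = ennreal (LINT x|M. F x (u x) / (L * \<mu>))"
      by (rule nn_integral_eq_integral[OF int]) (use AE_F_nonneg L \<mu> in \<open>auto elim: eventually_mono\<close>)
    also have "\<dots> = ennreal (\<rho> u / (L * \<mu>))" by (simp add: \<rho>_def)
    also have "\<dots> \<le> ennreal 1" using \<mu> L by (intro ennreal_leI) simp
    finally have "\<mu> \<in> {k. k > 0 \<and> (\<integral>\<^sup>+ x. ennreal (F x (u x / k)) \<partial>M) \<le> 1}" using \<mu> by simp
    then show ?thesis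
      unfolding luxemburg_norm_def \<mu>_def[symmetric] by (intro cInf_lower bdd_belowI[of _ 0]) auto
  qed
  with \<mu>0(1) show thesis by (rule that)
qed

end

section \<open>Minimisation of the energy functional\<close>

context semilinear_problem
begin

abbreviation V :: "('a \<Rightarrow> real) set" where "V \<equiv> energy_space \<Omega> \<Lambda> \<phi> s f"

abbreviation V_dual :: "(('a \<Rightarrow> real) \<Rightarrow> real) set" where
  "V_dual \<equiv> dual_space V (energy_norm \<Omega> \<Lambda> \<phi> s f)"

lemma V_H: "u \<in> V \<Longrightarrow> u \<in> \<H>" and V_LF: "u \<in> V \<Longrightarrow> u \<in> L\<^sub>F"
  by (simp_all add: energy_space_def)

lemma V_add: "u \<in> V \<Longrightarrow> v \<in> V \<Longrightarrow> (\<lambda>x. u x + v x) \<in> V"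
  by (simp add: energy_space_def H_add LF_add)

lemma V_cmult: "u \<in> V \<Longrightarrow> (\<lambda>x. c * u x) \<in> V"
  by (simp add: energy_space_def H_cmult LF_cmult)

lemma V_diff: "u \<in> V \<Longrightarrow> v \<in> V \<Longrightarrow> (\<lambda>x. u x - v x) \<in> V"
  using V_add[of u "\<lambda>x. (-1) * v x"] V_cmult[of v "-1"] by simp

lemma V_zero: "(\<lambda>x. 0) \<in> V"
proof -
  have "(\<lambda>x. 0) \<in> L\<^sub>F"
    by (rule LF_I[where g = "\<lambda>x. 0"]) (use AE_F_zero in \<open>auto elim: eventually_mono\<close>)
  moreover have "(\<lambda>x. 0) \<in> \<H>" by (simp add: Hr_def L2_iff fourier_coeff_def)
  ultimately show ?thesis by (simp add: energy_space_def)
qed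

lemma modular_add_le:
  obtains K where "K \<ge> 1" "\<And>u v. u \<in> L\<^sub>F \<Longrightarrow> v \<in> L\<^sub>F \<Longrightarrow> \<rho> (\<lambda>x. u x + v x) \<le> K * (\<rho> u + \<rho> v)"
proof -
  obtain K where K: "K \<ge> 1" "AE x in M. \<forall>a b. F x (a + b) \<le> K * (F x a + F x b)"
    using F_add by blast
  have "\<rho> (\<lambda>x. u x + v x) \<le> K * (\<rho> u + \<rho> v)" if u: "u \<in> L\<^sub>F" and v: "v \<in> L\<^sub>F" for u v
  proof -
    have "\<rho> (\<lambda>x. u x + v x) \<le> (LINT x|M. K * (F x (u x) + F x (v x)))"
      unfolding \<rho>_def
      by (rule integral_mono_AE)
         (use K(2) LF_integrable[OF LF_add[OF u v]] LF_integrable[OF u] LF_integrable[OF v] in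
          \<open>auto elim: eventually_mono\<close>)
    also have "\<dots> = K * (\<rho> u + \<rho> v)"
      using LF_integrable[OF u] LF_integrable[OF v] by (simp add: \<rho>_def)
    finally show ?thesis .
  qed
  with K(1) show thesis by (rule that)
qed

lemma modular_midpoint:
  assumes u: "u \<in> L\<^sub>F" and v: "v \<in> L\<^sub>F"
  shows "\<rho> (\<lambda>x. (1/2) * (u x + v x)) \<le> (\<rho> u + \<rho> v) / 2"
proof -
  have "\<rho> (\<lambda>x. (1/2) * (u x + v x)) \<le> (LINT x|M. (F x (u x) + F x (v x)) / 2)"
    unfolding \<rho>_def
    by (rule integral_mono_AE)
       (use AE_F_midpoint LF_integrable[OF LF_cmult[OF LF_add[OF u v]], of "1/2"]
            LF_integrable[OF u] LF_integrable[OF v] in \<open>auto elim: eventually_mono\<close>)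
  also have "\<dots> = (\<rho> u + \<rho> v) / 2"
    using LF_integrable[OF u] LF_integrable[OF v] by (simp add: \<rho>_def)
  finally show ?thesis .
qed

text \<open>The slope sits at the second function, so that in the variation argument
  \<open>f\<close> is evaluated at the perturbed point.\<close>

lemma modular_tangent:
  assumes u: "u \<in> L\<^sub>F" and v: "v \<in> L\<^sub>F"
  shows "\<rho> v - \<rho> u \<le> (LINT x|M. f x (v x) * (v x - u x))"
proof -
  have vu: "(\<lambda>x. v x - u x) \<in> L\<^sub>F"
    using LF_add[OF v LF_cmult[OF u, of "-1"]] by simp
  have "\<rho> v - \<rho> u = (LINT x|M. F x (v x) - F x (u x))"
    using LF_integrable[OF u] LF_integrable[OF v] by (simp add: \<rho>_def)
  also have "\<dots> \<le> (LINT x|M. f x (v x) * (v x - u x))"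
    by (rule integral_mono_AE)
       (use AE_F_tangent LF_integrable[OF u] LF_integrable[OF v] f_times_integrable[OF v vu] in
        \<open>auto elim: eventually_mono\<close>)
  finally show ?thesis .
qed

section \<open>Functionals on the energy space\<close>

lemma dual_add: "g \<in> V_dual \<Longrightarrow> u \<in> V \<Longrightarrow> v \<in> V \<Longrightarrow> g (\<lambda>x. u x + v x) = g u + g v"
  by (simp add: dual_space_def)

lemma dual_cmult: "g \<in> V_dual \<Longrightarrow> u \<in> V \<Longrightarrow> g (\<lambda>x. c * u x) = c * g u"
  by (simp add: dual_space_def)

lemma dual_diff: "g \<in> V_dual \<Longrightarrow> u \<in> V \<Longrightarrow> v \<in> V \<Longrightarrow> g (\<lambda>x. u x - v x) = g u - g v"
  using dual_add[of g u "\<lambda>x. (-1) * v x"] dual_cmult[of g v "-1"] V_cmult[of v "-1"] by simp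

text \<open>The order of choices matters: \<open>C\<close> is fixed, and only the additive constant
  \<open>B\<close> grows when \<epsilon> shrinks. The bound follows from
  \<open>luxemburg_norm_le\<close> with \<open>L = C / \<epsilon>\<close>.\<close>

lemma dual_bound:
  assumes g: "g \<in> V_dual"
  obtains C where "C \<ge> 0"
    and "\<And>\<epsilon>. \<epsilon> > 0 \<Longrightarrow> \<exists>B\<ge>0. \<forall>u\<in>V. \<bar>g u\<bar> \<le> C * sqrt (energy u u) + B + \<epsilon> * \<rho> u"
proof -
  obtain C0 where C0: "\<And>u. u \<in> V \<Longrightarrow> \<bar>g u\<bar> \<le> C0 * energy_norm \<Omega> \<Lambda> \<phi> s f u"
    using g unfolding dual_space_def by blast
  define C where "C = max C0 1"
  have C: "C > 0" "C0 \<le> C" by (auto simp: C_def)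
  show thesis
  proof
    show "C \<ge> 0" using C by simp
    fix \<epsilon> :: real assume \<epsilon>: "\<epsilon> > 0"
    obtain \<mu>0 where \<mu>0: "\<mu>0 > 0"
      "\<And>u. u \<in> L\<^sub>F \<Longrightarrow> luxemburg_norm \<Omega> f u \<le> \<mu>0 + \<rho> u / (C / \<epsilon>)"
      using luxemburg_norm_le[of "C / \<epsilon>"] C \<epsilon> by auto
    have "\<bar>g u\<bar> \<le> C * sqrt (energy u u) + C * \<mu>0 + \<epsilon> * \<rho> u" if u: "u \<in> V" for u
    proof -
      have "energy_norm \<Omega> \<Lambda> \<phi> s f u \<ge> 0"
        using luxemburg_norm_nonneg[OF structural V_LF[OF u]] energy_nonneg[of u]
        by (simp add: energy_norm_def Hr_norm_eq[OF V_H[OF u]])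
      then have "\<bar>g u\<bar> \<le> C * energy_norm \<Omega> \<Lambda> \<phi> s f u"
        using C0[OF u] C mult_right_mono order_trans by blast
      also have "\<dots> = C * sqrt (energy u u) + C * luxemburg_norm \<Omega> f u"
        by (simp add: energy_norm_def Hr_norm_eq[OF V_H[OF u]] algebra_simps)
      also have "C * luxemburg_norm \<Omega> f u \<le> C * (\<mu>0 + \<rho> u / (C / \<epsilon>))"
        using \<mu>0(2)[OF V_LF[OF u]] C by (intro mult_left_mono) auto
      also have "\<dots> = C * \<mu>0 + \<epsilon> * \<rho> u" using C \<epsilon> by (simp add: field_simps)
      finally show ?thesis by simp
    qed
    then show "\<exists>B\<ge>0. \<forall>u\<in>V. \<bar>g u\<bar> \<le> C * sqrt (energy u u) + B + \<epsilon> * \<rho> u"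
      using C \<mu>0 by (intro exI[of _ "C * \<mu>0"]) auto
  qed
qed

text \<open>A Banach--Saks argument replacing reflexivity of the energy space: sums of \<open>n\<close> sufficiently
  sparse terms of the sequence have modular of order \<open>n\<close>, so by superlinearity \<open>g\<close> is \<open>o(n)\<close> on
  them.\<close>

lemma dual_null_sequence:
  assumes g: "g \<in> V_dual" and v: "\<And>k. v k \<in> V"
    and energy: "(\<lambda>k. energy (v k) (v k)) \<longlonglongrightarrow> 0"
    and AE: "AE x in M. (\<lambda>k. v k x) \<longlonglongrightarrow> 0"
    and bound: "\<And>k. \<rho> (v k) \<le> A" and \<epsilon>: "\<epsilon> > 0"
  shows "\<exists>k. g (v k) < \<epsilon>"
proof (rule ccontr)
  assume "\<not> ?thesis"
  then have ge: "g (v k) \<ge> \<epsilon>" for k by (simp add: not_less)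
  obtain K where K: "K \<ge> 1" "AE x in M. \<forall>a b. F x (a + b) \<le> K * (F x a + F x b)"
    using F_add by blast
  \<comment> \<open>\<open>B\<close> is the cost in modular of one more summand: at most
    \<open>K * A\<close> from the summand itself and 1 as slack for the passage to the
    limit.\<close>
  define B where "B = K * A + 1"
  have "A \<ge> 0" using bound[of 0] modular_nonneg[of "v 0"] by simp
  then have B: "B > 0" using K by (simp add: B_def add_nonneg_pos)
  \<comment> \<open>Energy strictly below 1 is kept as the invariant, since it leaves room for one
    further term of sufficiently small energy.\<close>
  have sums: "\<exists>S\<in>V. energy S S < 1 \<and> \<rho> S \<le> n * B \<and> n * \<epsilon> \<le> g S" for n :: nat
  proof (induction n)
    case 0
    have "\<rho> (\<lambda>x. 0) = (LINT x|M. 0)"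
      unfolding \<rho>_def using F_measurable[of "\<lambda>x. 0"] AE_F_zero by (intro integral_cong_AE) auto
    then have "\<rho> (\<lambda>x. 0) = 0" by simp
    moreover have "g (\<lambda>x. 0) = 0" using dual_cmult[OF g V_zero, of 0] by simp
    moreover have "energy (\<lambda>x. 0) (\<lambda>x. 0) = 0"
      using energy_cmult_self[OF V_H[OF V_zero], of 0] by simp
    ultimately show ?case using V_zero by (intro bexI[of _ "\<lambda>x. 0"]) auto
  next
    case (Suc n)
    then obtain S where S: "S \<in> V" "energy S S < 1" "\<rho> S \<le> n * B" "n * \<epsilon> \<le> g S" by blast
    note [measurable] = F_measurable[OF LF_measurable[OF V_LF[OF S(1)]]]
    have int: "integrable M (\<lambda>x. F x (S x))" "integrable M (\<lambda>x. F x (v k x))"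
      "integrable M (\<lambda>x. F x (S x + v k x))" for k
      using LF_integrable V_LF S(1) v V_add by blast+
    \<comment> \<open>Using \<open>F_add\<close> directly would multiply \<open>\<rho> S\<close> by
      \<open>K\<close> at each step and give geometric growth. \<open>W k\<close> keeps only the
      part of \<open>F x (S x + v k x)\<close> not covered by \<open>K * F x (v k x)\<close>; it is
      dominated by \<open>K * F x (S x)\<close> and tends to \<open>F x (S x)\<close>, so
      \<open>\<rho> S\<close> enters with factor one.\<close>
    define W where "W k x = max 0 (F x (S x + v k x) - K * F x (v k x))" for k x
    have Wint: "integrable M (W k)" for k
      unfolding W_def using int by (intro integrable_max) auto
    have "(\<lambda>k. LINT x|M. W k x) \<longlonglongrightarrow> (LINT x|M. F x (S x))"
    proof (rule integral_dominated_convergence[where w = "\<lambda>x. K * F x (S x)"])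
      show "AE x in M. (\<lambda>k. W k x) \<longlonglongrightarrow> F x (S x)"
        using AE AE_isCont_F AE_F_zero AE_F_nonneg
      proof eventually_elim
        case (elim x)
        have "(\<lambda>k. F x (S x + v k x)) \<longlonglongrightarrow> F x (S x + 0)"
          using elim by (intro isCont_tendsto_compose[of _ "F x"] tendsto_intros) auto
        moreover have "(\<lambda>k. F x (v k x)) \<longlonglongrightarrow> F x 0"
          using elim by (intro isCont_tendsto_compose[of _ "F x"]) auto
        ultimately have "(\<lambda>k. W k x) \<longlonglongrightarrow> max 0 (F x (S x + 0) - K * F x 0)"
          unfolding W_def by (intro tendsto_intros)
        then show ?case using elim by (simp add: max_def)
      qed
      show "AE x in M. norm (W k x) \<le> K * F x (S x)" for k
        using K(2) AE_F_nonneg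
      proof eventually_elim
        case (elim x)
        have "F x (S x + v k x) \<le> K * F x (S x) + K * F x (v k x)"
          using elim(1) by (simp add: distrib_left)
        moreover have "0 \<le> K * F x (S x)" using K(1) elim(2) by simp
        ultimately show ?case by (simp add: W_def)
      qed
      show "integrable M (\<lambda>x. K * F x (S x))" using int by simp
      show "W k \<in> borel_measurable M" for k using Wint by auto
    qed (rule borel_measurable_integrable[OF int(1)])
    then have "\<forall>\<^sub>F k in sequentially. (LINT x|M. W k x) < \<rho> S + 1"
      unfolding \<rho>_def by (rule order_tendstoD) simp
    moreover have "\<forall>\<^sub>F k in sequentially. sqrt (energy S S) + sqrt (energy (v k) (v k)) < 1"
    proof (rule order_tendstoD(2))
      show "(\<lambda>k. sqrt (energy S S) + sqrt (energy (v k) (v k))) \<longlonglongrightarrow> sqrt (energy S S) + sqrt 0"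
        by (intro tendsto_intros energy)
      show "sqrt (energy S S) + sqrt 0 < 1" using S(2) by simp
    qed
    ultimately have "\<forall>\<^sub>F k in sequentially. (LINT x|M. W k x) < \<rho> S + 1
        \<and> sqrt (energy S S) + sqrt (energy (v k) (v k)) < 1"
      by (rule eventually_conj)
    then obtain k where k: "(LINT x|M. W k x) < \<rho> S + 1"
      "sqrt (energy S S) + sqrt (energy (v k) (v k)) < 1"
      by (auto simp: eventually_sequentially)
    let ?T = "\<lambda>x. S x + v k x"
    have "\<rho> ?T \<le> (LINT x|M. W k x + K * F x (v k x))"
      unfolding \<rho>_def by (rule integral_mono_AE) (use int Wint in \<open>auto simp: W_def\<close>)
    also have "\<dots> = (LINT x|M. W k x) + K * \<rho> (v k)"
      using int Wint by (simp add: \<rho>_def)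
    also have "\<dots> \<le> \<rho> S + 1 + K * A"
      using k(1) bound[of k] K by (intro add_mono mult_left_mono) auto
    also have "\<dots> \<le> Suc n * B" using S(3) by (simp add: B_def algebra_simps)
    finally have "\<rho> ?T \<le> Suc n * B" .
    moreover have "energy ?T ?T < 1"
      using energy_triangle[OF V_H[OF S(1)] V_H[OF v[of k]]] k(2) real_sqrt_lt_1_iff by fastforce
    moreover have "Suc n * \<epsilon> \<le> g ?T"
      using dual_add[OF g S(1) v[of k]] S(4) ge[of k] by (simp add: algebra_simps)
    ultimately show ?case using V_add[OF S(1) v] by blast
  qed
  obtain C where C: "C \<ge> 0"
    "\<And>\<epsilon>. \<epsilon> > 0 \<Longrightarrow> \<exists>B\<ge>0. \<forall>u\<in>V. \<bar>g u\<bar> \<le> C * sqrt (energy u u) + B + \<epsilon> * \<rho> u"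
    using dual_bound[OF g] by blast
  \<comment> \<open>With this multiple the modular term costs at most
    \<open>n * \<epsilon> / 2\<close>, half of the lower bound for \<open>g S\<close>; the other
    half exceeds \<open>C + D\<close> for large \<open>n\<close>.\<close>
  from C(2)[of "\<epsilon> / (2 * B)"] \<epsilon> B obtain D where
    D: "\<And>u. u \<in> V \<Longrightarrow> \<bar>g u\<bar> \<le> C * sqrt (energy u u) + D + \<epsilon> / (2 * B) * \<rho> u" by auto
  obtain n :: nat where n: "n > 2 * (C + D) / \<epsilon>" using reals_Archimedean2 by blast
  obtain S where S: "S \<in> V" "energy S S < 1" "\<rho> S \<le> n * B" "n * \<epsilon> \<le> g S" using sums by blast
  have "C * sqrt (energy S S) \<le> C * 1"
    using S(2) C(1) by (intro mult_left_mono) auto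
  moreover have "\<epsilon> / (2 * B) * \<rho> S \<le> \<epsilon> / (2 * B) * (n * B)"
    using S(3) \<epsilon> B by (intro mult_left_mono) auto
  moreover have "\<epsilon> / (2 * B) * (n * B) = n * \<epsilon> / 2" using B by simp
  ultimately have "n * \<epsilon> \<le> C + D + n * \<epsilon> / 2"
    using D[OF S(1)] S(4) by linarith
  then show False using n \<epsilon> by (simp add: field_simps)
qed

section \<open>The functional and its minimiser\<close>

definition J :: "(('a \<Rightarrow> real) \<Rightarrow> real) \<Rightarrow> ('a \<Rightarrow> real) \<Rightarrow> real" where
  "J g u = energy u u / 2 + \<rho> u - g u"

text \<open>Half of the modular pays for the modular part of \<open>g\<close>, and completing the
  square lets the quadratic energy absorb the linear one. The other half of the modular remains
  under control.\<close>

lemma J_lower_bound: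
  assumes g: "g \<in> V_dual"
  obtains D where "\<And>u. u \<in> V \<Longrightarrow> \<rho> u / 2 \<le> J g u + D"
proof -
  obtain C where C: "C \<ge> 0"
    "\<And>\<epsilon>. \<epsilon> > 0 \<Longrightarrow> \<exists>B\<ge>0. \<forall>u\<in>V. \<bar>g u\<bar> \<le> C * sqrt (energy u u) + B + \<epsilon> * \<rho> u"
    using dual_bound[OF g] by blast
  from C(2)[of "1/2"] obtain B where
    B: "\<And>u. u \<in> V \<Longrightarrow> \<bar>g u\<bar> \<le> C * sqrt (energy u u) + B + \<rho> u / 2" by auto
  have "\<rho> u / 2 \<le> J g u + (C\<^sup>2 / 2 + B)" if u: "u \<in> V" for u
  proof -
    have "0 \<le> (sqrt (energy u u) - C)\<^sup>2 / 2" by simp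
    also have "\<dots> = energy u u / 2 - C * sqrt (energy u u) + C\<^sup>2 / 2"
      using energy_nonneg[of u] by (simp add: power2_diff field_simps)
    finally show ?thesis using B[OF u] by (simp add: J_def)
  qed
  then show thesis by (rule that)
qed

text \<open>The modular and \<open>g\<close> contribute convexity and linearity; the quantitative
  gain is the parallelogram identity for the energy.\<close>

lemma J_midpoint:
  assumes g: "g \<in> V_dual" and u: "u \<in> V" and v: "v \<in> V"
  shows "J g (\<lambda>x. (1/2) * (u x + v x)) \<le> (J g u + J g v) / 2 - energy (\<lambda>x. u x - v x) (\<lambda>x. u x - v x) / 8"
proof -
  have H: "u \<in> \<H>" "v \<in> \<H>" using u v by (auto dest: V_H)
  have "energy (\<lambda>x. (1/2) * (u x + v x)) (\<lambda>x. (1/2) * (u x + v x))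
          = energy u u / 2 + energy v v / 2 - energy (\<lambda>x. u x - v x) (\<lambda>x. u x - v x) / 4"
    unfolding energy_cmult_self[OF H_add[OF H]] energy_add_self[OF H] energy_diff_self[OF H]
    by (simp add: power2_eq_square field_simps)
  moreover have "g (\<lambda>x. (1/2) * (u x + v x)) = (1/2) * (g u + g v)"
    unfolding dual_cmult[OF g V_add[OF u v]] dual_add[OF g u v] ..
  ultimately show ?thesis
    using modular_midpoint[OF V_LF[OF u] V_LF[OF v]] unfolding J_def by argo
qed

lemma J_minimizer:
  assumes g: "g \<in> V_dual"
  obtains u where "u \<in> V" "\<And>w. w \<in> V \<Longrightarrow> J g u \<le> J g w"
proof -
  obtain D where D: "\<And>u. u \<in> V \<Longrightarrow> \<rho> u / 2 \<le> J g u + D" using J_lower_bound[OF g] by blast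
  define m where "m = Inf (J g ` V)"
  have bdd: "bdd_below (J g ` V)"
  proof (rule bdd_belowI)
    show "- D \<le> y" if y: "y \<in> J g ` V" for y
    proof -
      from y obtain u where u: "u \<in> V" "y = J g u" by auto
      show ?thesis using D[OF u(1)] modular_nonneg[of u] u(2) by linarith
    qed
  qed
  have m: "m \<le> J g w" if "w \<in> V" for w
    unfolding m_def using that bdd by (intro cInf_lower) auto
  have "\<exists>u\<in>V. J g u < m + 1 / real (Suc k)" for k
    using cInf_lessD[of "J g ` V" "m + 1 / real (Suc k)"] V_zero by (auto simp: m_def)
  then obtain U where U: "\<And>k. U k \<in> V" "\<And>k. J g (U k) < m + 1 / real (Suc k)" by metis
  have UH: "U k \<in> \<H>" for k using U(1) by (rule V_H)
  \<comment> \<open>The midpoint cannot go below the infimum, so the gain of one eighth of the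
    squared distance is at most half the sum of the two excesses over \<open>m\<close>.\<close>
  have diff: "energy (\<lambda>x. U k x - U l x) (\<lambda>x. U k x - U l x) \<le> 4 / real (Suc k) + 4 / real (Suc l)" for k l
    using J_midpoint[OF g U(1) U(1), of k l] m[OF V_cmult[OF V_add[OF U(1) U(1)]], of "1/2" k l]
      U(2)[of k] U(2)[of l] by argo
  have "\<exists>N. \<forall>k\<ge>N. \<forall>l\<ge>N. energy (\<lambda>x. U k x - U l x) (\<lambda>x. U k x - U l x) \<le> e" if e: "e > 0" for e
  proof -
    obtain N where N: "8 / e < real N" using reals_Archimedean2 by blast
    have small: "4 / real (Suc k) \<le> e / 2" if "k \<ge> N" for k
    proof -
      have "8 / e \<le> real (Suc k)" using N that by linarith
      then show ?thesis using e by (simp add: field_simps)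
    qed
    have "energy (\<lambda>x. U k x - U l x) (\<lambda>x. U k x - U l x) \<le> e" if "k \<ge> N" "l \<ge> N" for k l
      using diff[of k l] small[OF that(1)] small[OF that(2)] by linarith
    then show ?thesis by blast
  qed
  then obtain u r where uH: "u \<in> \<H>" and r: "strict_mono r"
    and AE: "AE x in M. (\<lambda>k. U (r k) x) \<longlonglongrightarrow> u x"
    and lim: "(\<lambda>n. energy (\<lambda>x. U n x - u x) (\<lambda>x. U n x - u x)) \<longlonglongrightarrow> 0"
    by (rule energy_complete[OF UH])
  define A where "A = 2 * (m + 1 + D)"
  have UA: "\<rho> (U k) \<le> A" for k
  proof -
    have "J g (U k) < m + 1" by (rule less_le_trans[OF U(2)]) simp
    moreover have "\<rho> (U k) \<le> 2 * (J g (U k) + D)" using D[OF U(1)[of k]] by simp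
    ultimately show ?thesis by (simp add: A_def)
  qed
  \<comment> \<open>A second subsequence makes the modulars converge to some \<open>l\<close>; only
    \<open>\<rho> u \<le> l\<close> is obtained from Fatou.\<close>
  have "bounded (range (\<lambda>k. \<rho> (U (r k))))"
    using UA modular_nonneg by (intro boundedI[of _ A]) auto
  then obtain l q where q: "strict_mono q" and l: "(\<lambda>k. \<rho> (U (r (q k)))) \<longlonglongrightarrow> l"
    using bounded_imp_convergent_subsequence[of "\<lambda>k. \<rho> (U (r k))"] by (auto simp: comp_def)
  define p where "p = r \<circ> q"
  have p: "strict_mono p" unfolding p_def using r q by (rule strict_mono_o)
  define X where "X k = U (p k)" for k
  have X: "X k \<in> V" for k using U(1) by (simp add: X_def)
  have XAE: "AE x in M. (\<lambda>k. X k x) \<longlonglongrightarrow> u x"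
    using AE
  proof eventually_elim
    case (elim x)
    from LIMSEQ_subseq_LIMSEQ[OF elim q] show ?case by (simp add: X_def p_def comp_def)
  qed
  have Xl: "(\<lambda>k. \<rho> (X k)) \<longlonglongrightarrow> l" using l by (simp add: X_def p_def)
  have um: "u \<in> borel_measurable M" using H_L2[OF uH] by (simp add: L2_iff)
  have FX: "AE x in M. (\<lambda>k. F x (X k x)) \<longlonglongrightarrow> F x (u x)"
    using XAE AE_isCont_F by eventually_elim (auto intro: isCont_tendsto_compose)
  have FX0: "AE x in M. F x (X k x) \<ge> 0" for k using AE_F_nonneg by eventually_elim simp
  note Fatou = Fatou_limit[OF LF_integrable[OF V_LF[OF X]] FX0 F_measurable[OF um] FX Xl[unfolded \<rho>_def]]
  have u: "u \<in> V" using Fatou(1) um uH by (simp add: energy_space_def LF_def)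
  have \<rho>u: "\<rho> u \<le> l" using Fatou(2) by (simp add: \<rho>_def)
  define v where "v k x = X k x - u x" for k x
  have v: "v k \<in> V" for k unfolding v_def by (rule V_diff[OF X u])
  have vlim: "(\<lambda>k. energy (v k) (v k)) \<longlonglongrightarrow> 0"
    using LIMSEQ_subseq_LIMSEQ[OF lim p] by (simp add: v_def[abs_def] X_def comp_def)
  have vAE: "AE x in M. (\<lambda>k. v k x) \<longlonglongrightarrow> 0"
    using XAE by eventually_elim (auto simp: v_def LIM_zero_iff)
  obtain K where K: "K \<ge> 1" "\<And>u v. u \<in> L\<^sub>F \<Longrightarrow> v \<in> L\<^sub>F \<Longrightarrow> \<rho> (\<lambda>x. u x + v x) \<le> K * (\<rho> u + \<rho> v)"
    using modular_add_le by blast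
  have v\<rho>: "\<rho> (v k) \<le> K * (A + l)" for k
  proof -
    have minus: "\<rho> (\<lambda>x. - u x) \<le> \<rho> u"
      unfolding \<rho>_def
      using LF_integrable[OF LF_cmult[OF V_LF[OF u]], of "-1"] LF_integrable[OF V_LF[OF u]] AE_F_mono
      by (intro integral_mono_AE) (auto elim: eventually_mono)
    have "\<rho> (v k) \<le> K * (\<rho> (X k) + \<rho> (\<lambda>x. - u x))"
      using K(2)[OF V_LF[OF X[of k]] LF_cmult[OF V_LF[OF u], of "-1"]] by (simp add: v_def[abs_def])
    also have "\<dots> \<le> K * (A + l)"
      using K(1) UA[of "p k"] \<rho>u minus by (intro mult_left_mono) (auto simp: X_def)
    finally show ?thesis .
  qed
  have Xenergy: "(\<lambda>k. energy (X k) (X k)) \<longlonglongrightarrow> energy u u"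
  proof -
    have "energy (X k) (X k) = energy u u + 2 * energy u (v k) + energy (v k) (v k)" for k
      using energy_add_self[OF uH V_H[OF v[of k]]] by (simp add: v_def)
    moreover have "(\<lambda>k. energy u (v k)) \<longlonglongrightarrow> 0"
    proof (rule Lim_null_comparison)
      show "\<forall>\<^sub>F k in sequentially. norm (energy u (v k)) \<le> sqrt (energy u u) * sqrt (energy (v k) (v k))"
        using energy_Cauchy_Schwarz[OF uH V_H[OF v]] by simp
      show "(\<lambda>k. sqrt (energy u u) * sqrt (energy (v k) (v k))) \<longlonglongrightarrow> 0"
        using tendsto_mult[OF tendsto_const tendsto_real_sqrt[OF vlim]] by simp
    qed
    then have "(\<lambda>k. energy u u + 2 * energy u (v k) + energy (v k) (v k)) \<longlonglongrightarrow> energy u u + 2 * 0 + 0"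
      by (intro tendsto_intros vlim)
    ultimately show ?thesis by simp
  qed
  have JX: "(\<lambda>k. J g (X k)) \<longlonglongrightarrow> m"
  proof (rule tendsto_sandwich[OF _ _ tendsto_const])
    show "\<forall>\<^sub>F k in sequentially. m \<le> J g (X k)" using m X by simp
    show "\<forall>\<^sub>F k in sequentially. J g (X k) \<le> m + 1 / real (Suc (p k))"
      using U(2) by (simp add: X_def less_imp_le)
    have "(\<lambda>k. m + 1 / real (Suc k)) \<longlonglongrightarrow> m + 0"
      by (intro tendsto_intros LIMSEQ_Suc[OF lim_1_over_n])
    from LIMSEQ_subseq_LIMSEQ[OF this p] show "(\<lambda>k. m + 1 / real (Suc (p k))) \<longlonglongrightarrow> m"
      by (simp add: comp_def)
  qed
  \<comment> \<open>Solving the definition of \<open>J g (X k)\<close> for \<open>g (v k)\<close>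
    shows that these values converge, with limit \<delta>. As \<open>\<rho> u \<le> l\<close>, the
    value \<open>J g u\<close> exceeds \<open>m\<close> by at most \<delta>.\<close>
  define \<delta> where "\<delta> = energy u u / 2 + l - g u - m"
  have gv: "(\<lambda>k. g (v k)) \<longlonglongrightarrow> \<delta>"
  proof -
    have "g (v k) = energy (X k) (X k) / 2 + \<rho> (X k) - g u - J g (X k)" for k
      using dual_diff[OF g X u, of k] by (simp add: v_def[abs_def] J_def)
    moreover have "(\<lambda>k. energy (X k) (X k) / 2 + \<rho> (X k) - g u - J g (X k)) \<longlonglongrightarrow> \<delta>"
      unfolding \<delta>_def by (intro tendsto_intros Xenergy Xl JX) simp
    ultimately show ?thesis by simp
  qed
  have "\<delta> \<le> 0"
  proof (rule ccontr)
    assume "\<not> \<delta> \<le> 0"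
    then have \<delta>: "\<delta> / 2 > 0" "\<delta> / 2 < \<delta>" by auto
    from order_tendstoD(1)[OF gv \<delta>(2)] obtain N where N: "\<And>k. k \<ge> N \<Longrightarrow> \<delta> / 2 < g (v k)"
      by (auto simp: eventually_sequentially)
    \<comment> \<open>The sequence is shifted so that all its values of \<open>g\<close> exceed
      \<open>\<delta> / 2\<close>, which contradicts the averaging argument.\<close>
    have "\<exists>k. g (v (k + N)) < \<delta> / 2"
    proof (rule dual_null_sequence[OF g v _ _ v\<rho> \<delta>(1)])
      show "(\<lambda>k. energy (v (k + N)) (v (k + N))) \<longlonglongrightarrow> 0"
        using vlim by (rule LIMSEQ_ignore_initial_segment)
      show "AE x in M. (\<lambda>k. v (k + N) x) \<longlonglongrightarrow> 0"
        using vAE by eventually_elim (rule LIMSEQ_ignore_initial_segment)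
    qed
    then show False using N by (meson le_add2 less_asym)
  qed
  then have "J g u \<le> m" using \<rho>u by (simp add: J_def \<delta>_def)
  then have "J g u \<le> J g w" if "w \<in> V" for w using m[OF that] by linarith
  with u show thesis by (rule that)
qed

text \<open>Comparing \<open>u\<close> with \<open>u + t * v\<close>, dividing by a positive
  \<open>t\<close> and letting it tend to zero gives one inequality; the reverse one comes from
  replacing \<open>v\<close> by its negative.\<close>

lemma minimizer_variation:
  assumes g: "g \<in> V_dual" and u: "u \<in> V" and min: "\<And>w. w \<in> V \<Longrightarrow> J g u \<le> J g w" and v: "v \<in> V"
  shows "g v \<le> energy u v + (LINT x|M. f x (u x) * v x)"
proof -
  define t where "t n = 1 / real (Suc n)" for n
  have t: "0 < t n" "t n \<le> 1" for n by (auto simp: t_def)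
  have tlim: "t \<longlonglongrightarrow> 0" unfolding t_def by (rule LIMSEQ_Suc[OF lim_1_over_n])
  define w where "w n x = u x + t n * v x" for n x
  have tv: "(\<lambda>x. t n * v x) \<in> V" for n by (rule V_cmult[OF v])
  have w: "w n \<in> V" for n unfolding w_def by (rule V_add[OF u tv])
  have step: "g v \<le> energy u v + t n / 2 * energy v v + (LINT x|M. f x (w n x) * v x)" for n
  proof -
    have "energy (w n) (w n) = energy u u + 2 * (t n * energy u v) + (t n)\<^sup>2 * energy v v"
      unfolding w_def energy_add_self[OF V_H[OF u] V_H[OF tv]] energy_cmult_self[OF V_H[OF v]]
      using energy_cmult[OF V_H[OF v] V_H[OF u], of "t n"]
      by (simp add: energy_commute[of u v] energy_commute[of u "\<lambda>x. t n * v x"])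
    moreover have "\<rho> (w n) - \<rho> u \<le> t n * (LINT x|M. f x (w n x) * v x)"
    proof -
      have "\<rho> (w n) - \<rho> u \<le> (LINT x|M. f x (w n x) * (w n x - u x))"
        by (rule modular_tangent[OF V_LF[OF u] V_LF[OF w]])
      also have "\<dots> = (LINT x|M. t n * (f x (w n x) * v x))"
        by (intro Bochner_Integration.integral_cong) (auto simp: w_def)
      finally show ?thesis by simp
    qed
    moreover have "g (w n) = g u + t n * g v"
      unfolding w_def dual_add[OF g u tv] dual_cmult[OF g v] ..
    ultimately have "t n * g v \<le> t n * energy u v + (t n)\<^sup>2 * energy v v / 2 + t n * (LINT x|M. f x (w n x) * v x)"
      using min[OF w[of n]] unfolding J_def by argo
    also have "\<dots> = t n * (energy u v + t n / 2 * energy v v + (LINT x|M. f x (w n x) * v x))"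
      by (simp add: power2_eq_square algebra_simps)
    finally show ?thesis using t(1)[of n] by simp
  qed
  obtain K where K: "K \<ge> 1" "AE x in M. \<forall>a b. F x (a + b) \<le> K * (F x a + F x b)" using F_add by blast
  note int = LF_integrable[OF V_LF[OF u]] LF_integrable[OF V_LF[OF v]]
  have "(\<lambda>n. LINT x|M. f x (w n x) * v x) \<longlonglongrightarrow> (LINT x|M. f x (u x) * v x)"
  \<comment> \<open>The majorant does not depend on \<open>n\<close>: the product bound for
    \<open>f\<close> reduces to \<open>F x (w n x)\<close>, and \<open>t n \<le> 1\<close> bounds
    the perturbation by \<open>F x (v x)\<close>.\<close>
  proof (rule integral_dominated_convergence[where w = "\<lambda>x. (K * (F x (u x) + F x (v x)) + F x (v x)) / c1"])
    show "(\<lambda>x. f x (u x) * v x) \<in> borel_measurable M"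
      using f_times_integrable[OF V_LF[OF u] V_LF[OF v]] by auto
    show "(\<lambda>x. f x (w n x) * v x) \<in> borel_measurable M" for n
      using f_times_integrable[OF V_LF[OF w] V_LF[OF v]] by auto
    show "integrable M (\<lambda>x. (K * (F x (u x) + F x (v x)) + F x (v x)) / c1)" using int by simp
    show "AE x in M. (\<lambda>n. f x (w n x) * v x) \<longlonglongrightarrow> f x (u x) * v x"
      using AE_isCont_f
    proof eventually_elim
      case (elim x)
      have "(\<lambda>n. w n x) \<longlonglongrightarrow> u x + 0 * v x"
        unfolding w_def by (intro tendsto_intros tlim)
      then show ?case using elim by (intro tendsto_mult tendsto_const isCont_tendsto_compose[of _ "f x"]) auto
    qed
    show "AE x in M. norm (f x (w n x) * v x) \<le> (K * (F x (u x) + F x (v x)) + F x (v x)) / c1" for n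
      using AE_f_times_le K(2) AE_F_mono
    proof eventually_elim
      case (elim x)
      have "\<bar>f x (w n x) * v x\<bar> \<le> (F x (w n x) + F x (v x)) / c1" using elim(1) by blast
      also have "\<dots> \<le> (K * (F x (u x) + F x (v x)) + F x (v x)) / c1"
      proof (rule divide_right_mono)
        have "F x (w n x) \<le> K * (F x (u x) + F x (t n * v x))" using elim(2) by (simp add: w_def)
        also have "F x (t n * v x) \<le> F x (v x)"
          using t[of n] elim(3) by (simp add: abs_mult mult_le_cancel_right1 mult_left_le_one_le)
        finally show "F x (w n x) + F x (v x) \<le> K * (F x (u x) + F x (v x)) + F x (v x)"
          using K(1) by simp
      qed (use c1 in simp)
      finally show ?case by simp
    qed
  qed
  then have "(\<lambda>n. energy u v + t n / 2 * energy v v + (LINT x|M. f x (w n x) * v x))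
      \<longlonglongrightarrow> energy u v + 0 / 2 * energy v v + (LINT x|M. f x (u x) * v x)"
    by (intro tendsto_intros tlim) simp
  from LIMSEQ_le_const[OF this, of "g v"] step show ?thesis by auto
qed

section \<open>Existence, uniqueness and the a priori estimate\<close>

lemma weak_solution_iff:
  "weak_solution \<Omega> \<Lambda> \<phi> s f g u \<longleftrightarrow>
     u \<in> V \<and> (\<forall>v\<in>V. energy u v + (LINT x|M. f x (u x) * v x) = g v)"
  by (simp add: weak_solution_def energy_def ip_def)

lemma weak_solution_exists:
  assumes g: "g \<in> V_dual"
  shows "\<exists>u. weak_solution \<Omega> \<Lambda> \<phi> s f g u"
proof -
  obtain u where u: "u \<in> V" and min: "\<And>w. w \<in> V \<Longrightarrow> J g u \<le> J g w"
    using J_minimizer[OF g] by blast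
  have "energy u v + (LINT x|M. f x (u x) * v x) = g v" if v: "v \<in> V" for v
  proof (rule antisym)
    show "g v \<le> energy u v + (LINT x|M. f x (u x) * v x)"
      by (rule minimizer_variation[OF g u min v])
    have "g (\<lambda>x. (-1) * v x) \<le> energy u (\<lambda>x. (-1) * v x) + (LINT x|M. f x (u x) * ((-1) * v x))"
      by (rule minimizer_variation[OF g u min V_cmult[OF v]])
    then show "energy u v + (LINT x|M. f x (u x) * v x) \<le> g v"
      using dual_cmult[OF g v, of "-1"] energy_cmult[OF V_H[OF v] V_H[OF u], of "-1"]
      by (simp add: energy_commute[of u v] energy_commute[of u "\<lambda>x. - v x"])
  qed
  with u show ?thesis by (auto simp: weak_solution_iff)
qed

text \<open>Both equations are tested with the difference. Monotonicity of \<open>f x\<close> makes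
  the nonlinear contribution nonnegative, so the energy of the difference is at most zero.\<close>

lemma weak_solution_unique:
  assumes "weak_solution \<Omega> \<Lambda> \<phi> s f g u" "weak_solution \<Omega> \<Lambda> \<phi> s f g w"
  shows "AE x in M. u x = w x"
proof -
  let ?d = "\<lambda>x. u x - w x"
  have u: "u \<in> V" and w: "w \<in> V" using assms by (auto simp: weak_solution_iff)
  have d: "?d \<in> V" by (rule V_diff[OF u w])
  have "energy u ?d + (LINT x|M. f x (u x) * ?d x) = energy w ?d + (LINT x|M. f x (w x) * ?d x)"
    using assms d by (simp add: weak_solution_iff)
  then have "energy ?d ?d = - (LINT x|M. f x (u x) * ?d x - f x (w x) * ?d x)"
    using energy_diff[OF V_H[OF u] V_H[OF w] V_H[OF d]]
      f_times_integrable[OF V_LF[OF u] V_LF[OF d]] f_times_integrable[OF V_LF[OF w] V_LF[OF d]]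
    by simp
  also have "\<dots> \<le> 0"
  proof -
    have "AE x in M. 0 \<le> f x (u x) * ?d x - f x (w x) * ?d x"
      using AE_f_mono
    proof eventually_elim
      case (elim x)
      have "0 \<le> (f x (u x) - f x (w x)) * (u x - w x)"
        using elim by (cases "u x \<le> w x") (auto simp: mono_def intro: mult_nonpos_nonpos)
      then show ?case by (simp add: left_diff_distrib)
    qed
    then show ?thesis using integral_nonneg_AE by fastforce
  qed
  finally have "AE x in M. ?d x = 0" by (rule energy_eq_0_imp_AE[OF V_H[OF d]])
  then show ?thesis by eventually_elim simp
qed

text \<open>Testing with \<open>u\<close> and dropping the nonnegative term
  \<open>f x (u x) * u x\<close> gives the squared norm at most \<open>g u\<close>; normalising
  \<open>u\<close> then brings in the dual norm with constant one.\<close>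

lemma weak_solution_bound:
  assumes g: "g \<in> dual_space \<H> (Hr_norm \<Omega> \<Lambda> \<phi> s)" and sol: "weak_solution \<Omega> \<Lambda> \<phi> s f g u"
  shows "Hr_norm \<Omega> \<Lambda> \<phi> s u \<le> dual_norm \<H> (Hr_norm \<Omega> \<Lambda> \<phi> s) g"
proof -
  let ?N = "Hr_norm \<Omega> \<Lambda> \<phi> s"
  obtain C where C: "\<And>v. v \<in> \<H> \<Longrightarrow> \<bar>g v\<bar> \<le> C * ?N v"
    using g unfolding dual_space_def by blast
  have N0: "?N v \<ge> 0" if "v \<in> \<H>" for v using that energy_nonneg by (simp add: Hr_norm_eq)
  \<comment> \<open>The dual norm is a supremum of reals, which bounds its members only once the set
    is known to be bounded above.\<close>
  have "bdd_above ((\<lambda>v. \<bar>g v\<bar>) ` {v \<in> \<H>. ?N v \<le> 1})"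
  proof (rule bdd_aboveI2)
    fix v assume v: "v \<in> {v \<in> \<H>. ?N v \<le> 1}"
    then have "\<bar>g v\<bar> \<le> C * ?N v" using C by blast
    also have "\<dots> \<le> \<bar>C\<bar> * 1" using v N0 by (intro mult_mono) auto
    finally show "\<bar>g v\<bar> \<le> \<bar>C\<bar>" by simp
  qed
  then have upper: "\<bar>g v\<bar> \<le> dual_norm \<H> ?N g" if "v \<in> \<H>" "?N v \<le> 1" for v
    unfolding dual_norm_def using that by (intro cSUP_upper) auto
  have u: "u \<in> V" and uH: "u \<in> \<H>" using sol by (auto simp: weak_solution_iff dest: V_H)
  show ?thesis
  proof (cases "?N u = 0")
    \<comment> \<open>Here normalising is impossible, but \<open>u\<close> lies in the unit ball, so
      the dual norm is at least \<open>\<bar>g u\<bar>\<close> and hence nonnegative.\<close>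
    case True
    then show ?thesis using upper[OF uH] abs_ge_zero[of "g u"] by linarith
  next
    case False
    then have pos: "?N u > 0" using N0[OF uH] by simp
    have "AE x in M. 0 \<le> f x (u x) * u x"
      using AE_f_mono
    proof eventually_elim
      case (elim x)
      then show ?case using monoD[of "f x" 0 "u x"] monoD[of "f x" "u x" 0]
        by (cases "u x \<ge> 0") (auto intro: mult_nonpos_nonpos)
    qed
    then have "(?N u)\<^sup>2 \<le> energy u u + (LINT x|M. f x (u x) * u x)"
      using energy_nonneg[of u] integral_nonneg_AE by (fastforce simp: Hr_norm_eq[OF uH])
    also have "\<dots> = g u" using sol u by (simp add: weak_solution_iff)
    finally have le: "(?N u)\<^sup>2 \<le> g u" .
    let ?v = "\<lambda>x. inverse (?N u) * u x"
    have vH: "?v \<in> \<H>" by (rule H_cmult[OF uH])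
    have "energy u u = (?N u)\<^sup>2" using energy_nonneg[of u] by (simp add: Hr_norm_eq[OF uH])
    then have "energy ?v ?v = 1"
      using pos unfolding energy_cmult_self[OF uH] by (simp add: power_mult_distrib[symmetric])
    then have "?N ?v = 1" by (simp add: Hr_norm_eq[OF vH])
    then have "\<bar>g ?v\<bar> \<le> dual_norm \<H> ?N g" using upper[OF vH] by simp
    moreover have "g ?v = inverse (?N u) * g u" using g uH by (simp add: dual_space_def)
    moreover have "?N u \<le> inverse (?N u) * g u"
      using le pos by (simp add: field_simps power2_eq_square)
    ultimately show ?thesis by linarith
  qed
qed

end

theorem proposition2p8:
  fixes \<Omega> :: "(real ^ 'n) set" and s :: real
    and \<Lambda> :: "nat \<Rightarrow> real" and \<phi> :: "nat \<Rightarrow> real ^ 'n \<Rightarrow> real"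
    and f :: "real ^ 'n \<Rightarrow> real \<Rightarrow> real"
  assumes "open \<Omega>" and "bounded \<Omega>"
    and "dirichlet_eigensystem \<Omega> \<Lambda> \<phi>"
    and "0 < s" and "s < 1"
    and "structural_condition \<Omega> f" and "global_Delta2 \<Omega> f"
  shows "(\<forall>g\<in>dual_space (energy_space \<Omega> \<Lambda> \<phi> s f) (energy_norm \<Omega> \<Lambda> \<phi> s f).
            (\<exists>u. weak_solution \<Omega> \<Lambda> \<phi> s f g u) \<and>
            (\<forall>u w. weak_solution \<Omega> \<Lambda> \<phi> s f g u \<longrightarrow> weak_solution \<Omega> \<Lambda> \<phi> s f g w \<longrightarrow>
                   (AE x in lebesgue_on \<Omega>. u x = w x))) \<and>
         (\<exists>C>0. \<forall>g\<in>dual_space (Hr \<Omega> \<Lambda> \<phi> s) (Hr_norm \<Omega> \<Lambda> \<phi> s).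
            \<forall>u. weak_solution \<Omega> \<Lambda> \<phi> s f g u \<longrightarrow>
                Hr_norm \<Omega> \<Lambda> \<phi> s u \<le> C * dual_norm (Hr \<Omega> \<Lambda> \<phi> s) (Hr_norm \<Omega> \<Lambda> \<phi> s) g)"
proof -
  obtain c1 c2 where "c1 \<in> {0<..1}" "c2 \<in> {0<..1}" and
    "AE x in lebesgue_on \<Omega>. \<forall>t\<ge>0.
        c1 * (t * f x t) \<le> even_primitive f x t \<and> even_primitive f x t \<le> t * f x t \<and>
        c2 * (t * fibre_inverse f x t) \<le> even_primitive (fibre_inverse f) x t \<and>
        even_primitive (fibre_inverse f) x t \<le> t * fibre_inverse f x t"
    using assms(7) unfolding global_Delta2_def by blast
  then interpret semilinear_problem \<Omega> \<Lambda> \<phi> s f c1 c2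
    using assms(1-6) by unfold_locales auto
  show ?thesis
    using weak_solution_exists weak_solution_unique weak_solution_bound
    \<comment> \<open>The constant in the estimate is 1, uniformly in \<open>g\<close>.\<close>
    by (intro conjI ballI allI impI exI[of _ "1::real"]) auto
qed

end
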